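(* Let $\mathcal{H}$ be a weighted Hardy space satisfying axioms (A1), (A2), (A3), and let $W_{F,\phi}$ be a bounded weighted composition operator on $\mathcal{H}$, where $F$ is a function analytic in $\mathbb{D}$ and $\phi$ is an analytic map of $\mathbb{D}$ into itself. Then $W_{F,\phi}$ is unitary if and only if it is co-isometric (that is, if and only if $W_{F,\phi}W_{F,\phi}^{\ast}=I$). Moreover, either of these two properties is further equivalent to the following: (a) in the case when $\mathcal{H}$ is one of the spaces $\mathcal{H}_\gamma$, $\gamma>0$: $\phi$ is a disk automorphism and $F=\mu(\phi')^{\gamma/2}=\nu\,\dfrac{K_a}{\|K_a\|}$, where $a=\phi^{-1}(0)$ and $\mu,\nu$ are constants with $|\mu|=|\nu|=1$; (b) in the case when $\mathcal{H}$ does not belong to the scale of spaces $\mathcal{H}_\gamma$, $\gamma>0$: $\phi$ is a rotation and $F$ is a constant function of modulus one.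
   Context: $\mathbb{D}$ is the open unit disk in $\mathbb{C}$. A weighted Hardy space satisfying axioms (A1)--(A3) is a complex Hilbert space $\mathcal{H}$ of analytic functions in $\mathbb{D}$ such that: (A1) all point evaluations $f\mapsto f(w)$, $w\in\mathbb{D}$, are bounded on $\mathcal{H}$; hence there are reproducing kernels $K_w\in\mathcal{H}$ with $f(w)=\langle f,K_w\rangle$ for all $f\in\mathcal{H}$; (A2) $K_w(0)=1$ for all $w\in\mathbb{D}$; (A3) the monomials $z^n$, $n=0,1,2,\dots$, belong to $\mathcal{H}$ and form a complete (i.e. maximal) orthogonal set in $\mathcal{H}$. For $\gamma>0$, $\mathcal{H}_\gamma$ denotes the Hilbert space of analytic functions in $\mathbb{D}$ with reproducing kernel $K_w(z)=(1-\overline{w}z)^{-\gamma}=\sum_{n=0}^\infty\gamma(n)(\overline{w}z)^n$ (principal branch), where $\gamma(0)=1$, $\gamma(1)=\gamma$ and $\gamma(n)=\frac{\Gamma(n+\gamma)}{\Gamma(\gamma)\,n!}$ for $n\ge 1$. For $F$ analytic in $\mathbb{D}$ and $\phi:\mathbb{D}\to\mathbb{D}$ analytic, the weighted composition operator is $W_{F,\phi}f=F\,(f\circ\phi)$. A bounded operator $T$ on a Hilbert space is co-isometric if $TT^\ast=I$ and unitary if $TT^\ast=T^\ast T=I$. A disk automorphism is an injective analytic function from $\mathbb{D}$ onto $\mathbb{D}$; a rotation is a map $z\mapsto\lambda z$ with $|\lambda|=1$. For a disk automorphism $\phi$, the derivative $\phi'$ does not vanish in $\mathbb{D}$, and $(\phi')^{\gamma/2}$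 denotes an analytic branch of the power in $\mathbb{D}$ (different branches differ by a constant factor of modulus one). *)

theory Defs
  imports "HOL-Complex_Analysis.Complex_Analysis"
begin

abbreviation unit_disk :: "complex set" where
  "unit_disk \<equiv> ball 0 1"

type_synonym cfun = "complex \<Rightarrow> complex"

(* A space of functions on the disk is given by its carrier H and its inner product ip, which
   only matters on H.  Functions on the disk are represented by total functions that vanish
   outside the disk, so that equality on the disk is HOL equality. *)

definition on_disk :: "cfun \<Rightarrow> cfun" where
  "on_disk f = (\<lambda>z. if z \<in> unit_disk then f z else 0)"

definition hnorm :: "(cfun \<Rightarrow> cfun \<Rightarrow> complex) \<Rightarrow> cfun \<Rightarrow> real" where
  "hnorm ip f = sqrt (Re (ip f f))"

text \<open>Complex Hilbert spaces of analytic functions in the disk; the inner product is linear in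
  the first argument.\<close>

locale disk_hilbert_space =
  fixes H :: "cfun set" and ip :: "cfun \<Rightarrow> cfun \<Rightarrow> complex"
  assumes analytic: "f \<in> H \<Longrightarrow> f holomorphic_on unit_disk"
    and vanish_outside: "f \<in> H \<Longrightarrow> z \<notin> unit_disk \<Longrightarrow> f z = 0"
    and zero_mem: "(\<lambda>z. 0) \<in> H"
    and add_mem: "f \<in> H \<Longrightarrow> g \<in> H \<Longrightarrow> (\<lambda>z. f z + g z) \<in> H"
    and scale_mem: "f \<in> H \<Longrightarrow> (\<lambda>z. c * f z) \<in> H"
    and ip_add: "f \<in> H \<Longrightarrow> g \<in> H \<Longrightarrow> h \<in> H \<Longrightarrow> ip (\<lambda>z. f z + g z) h = ip f h + ip g h"
    and ip_scale: "f \<in> H \<Longrightarrow> h \<in> H \<Longrightarrow> ip (\<lambda>z. c * f z) h = c * ip f h"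
    and ip_cnj: "f \<in> H \<Longrightarrow> g \<in> H \<Longrightarrow> ip g f = cnj (ip f g)"
    and ip_nonneg: "f \<in> H \<Longrightarrow> 0 \<le> Re (ip f f)"
    and ip_definite: "f \<in> H \<Longrightarrow> ip f f = 0 \<Longrightarrow> f = (\<lambda>z. 0)"
    and complete: "\<lbrakk>\<And>n. X n \<in> H;
        \<forall>e>0. \<exists>N. \<forall>m\<ge>N. \<forall>n\<ge>N. hnorm ip (\<lambda>z. X m z - X n z) < e\<rbrakk>
        \<Longrightarrow> \<exists>f\<in>H. (\<lambda>n. hnorm ip (\<lambda>z. X n z - f z)) \<longlonglongrightarrow> 0"

locale disk_rkhs = disk_hilbert_space H ip
  for H :: "cfun set" and ip :: "cfun \<Rightarrow> cfun \<Rightarrow> complex" +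
  assumes bounded_eval: "w \<in> unit_disk \<Longrightarrow> \<exists>C. \<forall>f\<in>H. cmod (f w) \<le> C * hnorm ip f"

text \<open>Existence and uniqueness of this function, for a space with bounded point evaluations, is
  the Riesz representation theorem.\<close>

definition rep_kernel :: "cfun set \<Rightarrow> (cfun \<Rightarrow> cfun \<Rightarrow> complex) \<Rightarrow> complex \<Rightarrow> cfun" where
  "rep_kernel H ip w = (THE k. k \<in> H \<and> (\<forall>f\<in>H. f w = ip f k))"

definition orthogonal_set :: "cfun set \<Rightarrow> (cfun \<Rightarrow> cfun \<Rightarrow> complex) \<Rightarrow> cfun set \<Rightarrow> bool" where
  "orthogonal_set H ip S \<longleftrightarrow> S \<subseteq> H \<and> (\<lambda>z. 0) \<notin> S \<and> (\<forall>f\<in>S. \<forall>g\<in>S. f \<noteq> g \<longrightarrow> ip f g = 0)"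

definition maximal_orthogonal_set ::
    "cfun set \<Rightarrow> (cfun \<Rightarrow> cfun \<Rightarrow> complex) \<Rightarrow> cfun set \<Rightarrow> bool" where
  "maximal_orthogonal_set H ip S \<longleftrightarrow>
     orthogonal_set H ip S \<and> (\<forall>T. orthogonal_set H ip T \<and> S \<subseteq> T \<longrightarrow> T = S)"

locale weighted_hardy_space = disk_rkhs H ip
  for H :: "cfun set" and ip :: "cfun \<Rightarrow> cfun \<Rightarrow> complex" +
  assumes kernel_at_0: "w \<in> unit_disk \<Longrightarrow> rep_kernel H ip w 0 = 1"
    and monomials: "maximal_orthogonal_set H ip (range (\<lambda>n::nat. on_disk (\<lambda>z. z ^ n)))"

text \<open>A Hilbert space of functions is determined by its reproducing kernel, so for given
  \<open>\<gamma> > 0\<close> this singles out the pair consisting of the space and its inner product on it.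
  On the disk \<open>1 - cnj w * z\<close> has positive real part and \<open>powr\<close> is the principal branch.\<close>

definition is_H_gamma :: "real \<Rightarrow> cfun set \<Rightarrow> (cfun \<Rightarrow> cfun \<Rightarrow> complex) \<Rightarrow> bool" where
  "is_H_gamma \<gamma> H ip \<longleftrightarrow> disk_rkhs H ip \<and>
     (\<forall>w\<in>unit_disk. \<forall>z\<in>unit_disk.
        rep_kernel H ip w z = (1 - cnj w * z) powr (- complex_of_real \<gamma>))"

definition weighted_comp :: "cfun \<Rightarrow> cfun \<Rightarrow> cfun \<Rightarrow> cfun" where
  "weighted_comp F \<phi> f = on_disk (\<lambda>z. F z * f (\<phi> z))"

definition bounded_operator ::
    "cfun set \<Rightarrow> (cfun \<Rightarrow> cfun \<Rightarrow> complex) \<Rightarrow> (cfun \<Rightarrow> cfun) \<Rightarrow> bool" where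
  "bounded_operator H ip T \<longleftrightarrow> T ` H \<subseteq> H \<and>
     (\<forall>f\<in>H. \<forall>g\<in>H. T (\<lambda>z. f z + g z) = (\<lambda>z. T f z + T g z)) \<and>
     (\<forall>c. \<forall>f\<in>H. T (\<lambda>z. c * f z) = (\<lambda>z. c * T f z)) \<and>
     (\<exists>C. \<forall>f\<in>H. hnorm ip (T f) \<le> C * hnorm ip f)"

definition hilbert_adjoint ::
    "cfun set \<Rightarrow> (cfun \<Rightarrow> cfun \<Rightarrow> complex) \<Rightarrow> (cfun \<Rightarrow> cfun) \<Rightarrow> cfun \<Rightarrow> cfun" where
  "hilbert_adjoint H ip T g = (THE h. h \<in> H \<and> (\<forall>f\<in>H. ip (T f) g = ip f h))"

definition co_isometric ::
    "cfun set \<Rightarrow> (cfun \<Rightarrow> cfun \<Rightarrow> complex) \<Rightarrow> (cfun \<Rightarrow> cfun) \<Rightarrow> bool" where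
  "co_isometric H ip T \<longleftrightarrow> (\<forall>f\<in>H. T (hilbert_adjoint H ip T f) = f)"

definition unitary_operator ::
    "cfun set \<Rightarrow> (cfun \<Rightarrow> cfun \<Rightarrow> complex) \<Rightarrow> (cfun \<Rightarrow> cfun) \<Rightarrow> bool" where
  "unitary_operator H ip T \<longleftrightarrow>
     (\<forall>f\<in>H. T (hilbert_adjoint H ip T f) = f) \<and> (\<forall>f\<in>H. hilbert_adjoint H ip T (T f) = f)"

definition disk_automorphism :: "cfun \<Rightarrow> bool" where
  "disk_automorphism \<phi> \<longleftrightarrow> \<phi> holomorphic_on unit_disk \<and> bij_betw \<phi> unit_disk unit_disk"

definition rotation :: "cfun \<Rightarrow> bool" where
  "rotation \<phi> \<longleftrightarrow> (\<exists>c. cmod c = 1 \<and> (\<forall>z\<in>unit_disk. \<phi> z = c * z))"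

text \<open>\<open>p\<close> is an analytic branch of the power \<open>g\<^sup>\<alpha>\<close>, obtained from an analytic branch of
  \<open>log g\<close>.  Two branches of the same power differ by a constant factor of modulus one.\<close>

definition power_branch :: "cfun \<Rightarrow> real \<Rightarrow> cfun \<Rightarrow> bool" where
  "power_branch g \<alpha> p \<longleftrightarrow>
     (\<exists>L. L holomorphic_on unit_disk \<and>
        (\<forall>z\<in>unit_disk. exp (L z) = g z \<and> p z = exp (of_real \<alpha> * L z)))"

end

(* Write K_w(z) = k(cnj w * z), where k has the Taylor coefficients 1 / ||z^n||^2 > 0.  Since
   W* K_w = cnj (F w) K_(phi w), the operator is co-isometric iff
     cnj (F w) F z k(cnj (phi w) phi z) = k(cnj w z)   for all w, z in the disk.
   A co-isometric W is onto; its range contains 1 and z, so phi is injective, hence W is injective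
   and therefore unitary.  If phi 0 = 0, then F is constant and |phi z| = |z|, so phi is a rotation.
   If b = phi 0 is not 0, the coefficients of cnj w and (cnj w)^2 in the identity express
   x k'/k at x = cnj b * phi z as an affine function of z and x^2 k''/k as a quadratic polynomial
   in z.  Eliminating z gives k'' k = alpha k'^2, so (1 - s x) k' = gamma k for a constant s, and
   phi is a Moebius map.  Positivity of k on [0,1) forces s <= 1, and phi mapping the disk into
   itself forces s >= 1.  So k(x) = (1 - x)^(-gamma) and phi is an automorphism. *)

theory Submission
  imports Defs
begin

subsection \<open>Kernels of weighted Hardy spaces\<close>

text \<open>The overview takes kernels and adjoints for granted. Both are definite descriptions, so
  Riesz representation has to be established; maximality of the monomials turns this into a matter
  of coefficients. The equation for kernels is holomorphic in \<open>z\<close> but antiholomorphic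
  in \<open>w\<close>. Writing \<open>x\<close> for \<open>cnj w\<close> and passing to the
  reflected symbol \<open>cnj (\<phi> (cnj x))\<close> makes both variables holomorphic, so that
  comparing coefficients becomes complex differentiation at \<open>x = 0\<close>. Beforehand
  \<open>F\<close> is eliminated, since the equation at \<open>w = 0\<close> expresses it through
  \<open>k\<close> and \<open>\<phi>\<close>. Two orders suffice: the first recovers
  \<open>z\<close> from \<open>\<phi> z\<close>, the second then leaves a relation for
  \<open>k\<close> alone, valid on an open set and hence on the whole disk. Zeros of
  \<open>k\<close> are not excluded a priori, which is why these relations are kept free of division
  by \<open>k\<close>. In the converse direction the obstacle is that complex powers multiply as
  expected only if the principal logarithms add up without a multiple of 2 pi i.\<close>

definition kernel_identity :: "cfun \<Rightarrow> cfun \<Rightarrow> cfun \<Rightarrow> bool" where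
  "kernel_identity k F \<phi> \<longleftrightarrow> (\<forall>w\<in>unit_disk. \<forall>z\<in>unit_disk.
     cnj (F w) * F z * k (cnj (\<phi> w) * \<phi> z) = k (cnj w * z))"

lemma disk_mult_mem: "x \<in> unit_disk \<Longrightarrow> y \<in> unit_disk \<Longrightarrow> x * y \<in> unit_disk" for x y :: complex
  using norm_mult_less[of x 1 y 1] by simp

lemma disk_factor:
  assumes "x \<in> unit_disk"
  obtains w z where "w \<in> unit_disk" "z \<in> unit_disk" "x = cnj w * z"
proof -
  define r where "r = (1 + cmod x) / 2"
  have r: "0 < r" "r < 1" "cmod x < r"
    using assms norm_ge_zero[of x] by (simp_all add: r_def add_pos_nonneg)
  then show ?thesis
    by (intro that[of "of_real r" "x / of_real r"]) (simp_all add: norm_divide)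
qed

section \<open>Inner product spaces: Cauchy-Schwarz and weak continuity\<close>

context disk_hilbert_space
begin

lemma diff_mem: "f \<in> H \<Longrightarrow> g \<in> H \<Longrightarrow> (\<lambda>z. f z - g z) \<in> H"
  using add_mem[of f "\<lambda>z. (-1) * g z"] scale_mem[of g "-1"] by simp

lemma ip_scale_right: "f \<in> H \<Longrightarrow> h \<in> H \<Longrightarrow> ip h (\<lambda>z. c * f z) = cnj c * ip h f"
  using ip_cnj[OF scale_mem[of f c], of h] ip_cnj[of f h] by (simp add: ip_scale)

lemma ip_diff: "f \<in> H \<Longrightarrow> g \<in> H \<Longrightarrow> h \<in> H \<Longrightarrow> ip (\<lambda>z. f z - g z) h = ip f h - ip g h"
  using ip_add[of f "\<lambda>z. (-1) * g z" h] ip_scale[of g h "-1"] scale_mem[of g "-1"] by simp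

lemma ip_diff_right: "f \<in> H \<Longrightarrow> g \<in> H \<Longrightarrow> h \<in> H \<Longrightarrow> ip h (\<lambda>z. f z - g z) = ip h f - ip h g"
  using ip_cnj[OF diff_mem[of f g], of h] ip_cnj[of f h] ip_cnj[of g h] by (simp add: ip_diff)

lemma ip_zero: "h \<in> H \<Longrightarrow> ip (\<lambda>z. 0) h = 0"
  using ip_scale[OF zero_mem, of h 0] by simp

lemma ip_self: "f \<in> H \<Longrightarrow> ip f f = of_real ((hnorm ip f)\<^sup>2)"
  using ip_cnj[of f f] ip_nonneg[of f] by (simp add: hnorm_def complex_eq_iff)

lemma hnorm_nonneg: "f \<in> H \<Longrightarrow> 0 \<le> hnorm ip f"
  by (simp add: hnorm_def ip_nonneg)

lemma hnorm_pos: "f \<in> H \<Longrightarrow> f \<noteq> (\<lambda>z. 0) \<Longrightarrow> 0 < hnorm ip f"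
  using ip_definite[of f] ip_self[of f] hnorm_nonneg[of f] by force

lemma eq_if_ip_eq:
  assumes "f \<in> H" "g \<in> H" "\<And>h. h \<in> H \<Longrightarrow> ip h f = ip h g"
  shows "f = g"
proof -
  have "ip (\<lambda>z. f z - g z) (\<lambda>z. f z - g z) = 0"
    using assms by (simp add: ip_diff_right diff_mem)
  from ip_definite[OF diff_mem[OF assms(1,2)] this] show ?thesis
    by (auto simp: fun_eq_iff)
qed

lemma Cauchy_Schwarz:
  assumes f: "f \<in> H" and g: "g \<in> H"
  shows "cmod (ip f g) \<le> hnorm ip f * hnorm ip g"
proof (cases "g = (\<lambda>z. 0)")
  case True
  then show ?thesis
    using ip_cnj[OF g f] ip_zero[OF f] f g by (simp add: hnorm_nonneg)
next
  case False
  define n where "n = (hnorm ip g)\<^sup>2"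
  have n: "n > 0" using hnorm_pos[OF g False] by (simp add: n_def)
  define a where "a = ip f g / of_real n"
  \<comment> \<open>The component of \<open>f\<close> orthogonal to \<open>g\<close>; its squared
    norm being nonnegative is the inequality.\<close>
  define h where "h = (\<lambda>z. f z - a * g z)"
  have ag: "(\<lambda>z. a * g z) \<in> H" using g by (rule scale_mem)
  have h: "h \<in> H" unfolding h_def using f ag by (rule diff_mem)
  have "ip h g = 0"
    unfolding h_def using f g ag n by (simp add: ip_diff ip_scale ip_self flip: n_def) (simp add: a_def)
  then have "ip h h = ip h f"
    using f g ag h by (subst (2) h_def) (simp add: ip_diff_right ip_scale_right)
  also have "\<dots> = of_real ((hnorm ip f)\<^sup>2) - a * ip g f"
    unfolding h_def using f g ag by (simp add: ip_diff ip_scale ip_self)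
  also have "a * ip g f = of_real ((cmod (ip f g))\<^sup>2 / n)"
    using ip_cnj[OF f g] complex_norm_square[of "ip f g"] by (simp add: a_def)
  finally have "(hnorm ip f)\<^sup>2 - (cmod (ip f g))\<^sup>2 / n = Re (ip h h)"
    by (metis Re_complex_of_real of_real_diff)
  also have "\<dots> \<ge> 0" using h by (rule ip_nonneg)
  finally have "(cmod (ip f g))\<^sup>2 \<le> (hnorm ip f * hnorm ip g)\<^sup>2"
    using n by (simp add: n_def field_simps)
  then show ?thesis
    by (rule power2_le_imp_le) (simp add: f g hnorm_nonneg)
qed

lemma tendsto_ip:
  assumes "\<And>n. X n \<in> H" "f \<in> H" "h \<in> H"
    and lim: "(\<lambda>n. hnorm ip (\<lambda>z. X n z - f z)) \<longlonglongrightarrow> 0"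
  shows "(\<lambda>n. ip (X n) h) \<longlonglongrightarrow> ip f h"
proof (rule LIM_zero_cancel, rule Lim_null_comparison)
  have "norm (ip (X n) h - ip f h) \<le> hnorm ip (\<lambda>z. X n z - f z) * hnorm ip h" for n
    using Cauchy_Schwarz[OF diff_mem[OF assms(1,2)] assms(3)] unfolding ip_diff[OF assms(1-3)] .
  then show "\<forall>\<^sub>F n in sequentially. norm (ip (X n) h - ip f h) \<le> hnorm ip (\<lambda>z. X n z - f z) * hnorm ip h"
    by (rule always_eventually[OF allI])
  show "(\<lambda>n. hnorm ip (\<lambda>z. X n z - f z) * hnorm ip h) \<longlonglongrightarrow> 0"
    using tendsto_mult_right[OF lim, of "hnorm ip h"] by simp
qed

lemma sum_mem:
  assumes "\<And>i. i \<in> I \<Longrightarrow> f i \<in> H"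
  shows "(\<lambda>z. \<Sum>i\<in>I. f i z) \<in> H"
  using assms by (induction I rule: infinite_finite_induct) (auto simp: zero_mem add_mem)

lemma ip_sum:
  assumes "\<And>i. i \<in> I \<Longrightarrow> f i \<in> H" "h \<in> H"
  shows "ip (\<lambda>z. \<Sum>i\<in>I. f i z) h = (\<Sum>i\<in>I. ip (f i) h)"
  using assms by (induction I rule: infinite_finite_induct) (auto simp: ip_zero ip_add sum_mem)

end

section \<open>The monomial basis: Riesz-Fischer, expansions and Riesz representation\<close>

context weighted_hardy_space
begin

definition e :: "nat \<Rightarrow> complex \<Rightarrow> complex" where "e n = on_disk (\<lambda>z. z ^ n)"

definition c :: "nat \<Rightarrow> real" where "c n = 1 / (hnorm ip (e n))\<^sup>2"

lemma e_mem: "e n \<in> H"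
  using monomials unfolding maximal_orthogonal_set_def orthogonal_set_def e_def by blast

lemma e_apply: "z \<in> unit_disk \<Longrightarrow> e n z = z ^ n"
  by (simp add: e_def on_disk_def)

lemma e_neq_0: "e n \<noteq> (\<lambda>z. 0)"
  using e_apply[of "1/2" n] by (force simp: norm_divide dest: fun_cong[where x = "1/2"])

lemma c_pos: "c n > 0"
  using hnorm_pos[OF e_mem e_neq_0, of n] by (simp add: c_def)

lemma orthogonal_e: "orthogonal_set H ip (range e)"
  using monomials by (simp add: maximal_orthogonal_set_def e_def)

text \<open>The monomials are given as a set, so orthogonality is known only for distinct functions;
  this transfers it to distinct exponents. Moduli at 1/2 separate the exponents.\<close>

lemma inj_e: "inj e"
proof
  fix m n assume "e m = e n"
  then have "e m (1/2) = e n (1/2)" by simp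
  then have "(1/2 :: complex) ^ m = (1/2) ^ n" by (simp add: e_apply norm_divide)
  then have "cmod ((1/2) ^ m) = cmod ((1/2) ^ n)" by simp
  then have "(1/2 :: real) ^ m = (1/2) ^ n" by (simp add: norm_power norm_divide)
  then show "m = n" by (subst (asm) power_inject_exp') auto
qed

lemma ip_e: "ip (e m) (e n) = (if m = n then of_real (1 / c n) else 0)"
proof (cases "m = n")
  case True
  then show ?thesis by (simp add: ip_self e_mem c_def)
next
  case False
  then have "e m \<noteq> e n" using inj_e by (auto dest: injD)
  then show ?thesis
    using orthogonal_e False by (auto simp: orthogonal_set_def)
qed

text \<open>Otherwise \<open>f\<close> could be adjoined to the maximal orthogonal set, so it would
  already be a monomial and hence orthogonal to itself.\<close>

lemma eq_0_if_orthogonal: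
  assumes f: "f \<in> H" and orth: "\<And>n. ip f (e n) = 0"
  shows "f = (\<lambda>z. 0)"
proof (rule ccontr)
  assume nz: "f \<noteq> (\<lambda>z. 0)"
  have orth': "ip (e n) f = 0" for n using ip_cnj[OF f e_mem] orth by simp
  have "orthogonal_set H ip (insert f (range e))"
    using orthogonal_e f nz orth orth' by (auto simp: orthogonal_set_def)
  then have "insert f (range e) = range e"
    using monomials by (auto simp: maximal_orthogonal_set_def e_def)
  then obtain n where "f = e n" by blast
  then have "ip f f = 0" using orth by simp
  with f nz show False by (auto dest: ip_definite)
qed

definition partial :: "(nat \<Rightarrow> complex) \<Rightarrow> nat set \<Rightarrow> complex \<Rightarrow> complex" where
  "partial a I = (\<lambda>z. \<Sum>i\<in>I. a i * e i z)"

lemma partial_mem: "partial a I \<in> H"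
  unfolding partial_def by (intro sum_mem scale_mem e_mem)

lemma ip_partial: "h \<in> H \<Longrightarrow> ip (partial a I) h = (\<Sum>i\<in>I. a i * ip (e i) h)"
  unfolding partial_def by (simp add: ip_sum ip_scale scale_mem e_mem)

lemma ip_partial_e: "finite I \<Longrightarrow> ip (partial a I) (e n) = (if n \<in> I then a n / c n else 0)"
  by (simp add: ip_partial e_mem ip_e if_distrib[where f = "\<lambda>x. _ * x"] sum.delta' cong: if_cong)

lemma ip_e_partial: "finite I \<Longrightarrow> ip (e n) (partial a I) = (if n \<in> I then cnj (a n) / c n else 0)"
  using ip_cnj[OF partial_mem[of a I] e_mem[of n]] by (simp add: ip_partial_e)

lemma ip_partial_self:
  assumes "finite I"
  shows "ip (partial a I) (partial a I) = of_real (\<Sum>i\<in>I. (cmod (a i))\<^sup>2 / c i)"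
proof -
  have "ip (partial a I) (partial a I) = (\<Sum>i\<in>I. a i * (cnj (a i) / c i))"
    using assms by (simp add: ip_partial partial_mem ip_e_partial)
  then show ?thesis by (simp add: complex_norm_square[symmetric] del: of_real_power)
qed

lemma hnorm_partial:
  assumes "finite I"
  shows "hnorm ip (partial a I) = sqrt (\<Sum>i\<in>I. (cmod (a i))\<^sup>2 / c i)"
  unfolding hnorm_def ip_partial_self[OF assms] by simp

text \<open>The blocks of partial sums have squared norm equal to blocks of a convergent series, so
  completeness supplies the limit; its coefficients follow by weak continuity. The weights
  \<open>1 / c i\<close> are the squared norms of the unnormalized monomials.\<close>

lemma Riesz_Fischer:
  assumes bd: "\<And>n. (\<Sum>i<n. (cmod (a i))\<^sup>2 / c i) \<le> B"
  obtains g where "g \<in> H" "(\<lambda>n. hnorm ip (\<lambda>z. partial a {..<n} z - g z)) \<longlonglongrightarrow> 0"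
    "\<And>n. ip g (e n) = a n / c n"
proof -
  let ?t = "\<lambda>i. (cmod (a i))\<^sup>2 / c i"
  have t: "?t i \<ge> 0" for i using c_pos[of i] by simp
  have sm: "summable ?t"
    using bd t by (intro summableI_nonneg_bounded[where x = B]) auto
  have diff: "hnorm ip (\<lambda>z. partial a {..<m} z - partial a {..<n} z) = sqrt (sum ?t {n..<m})"
    if "n \<le> m" for m n
  proof -
    have "partial a {..<m} z - partial a {..<n} z = partial a {n..<m} z" for z
      using that by (simp add: partial_def sum_diff_nat_ivl lessThan_atLeast0)
    then have "(\<lambda>z. partial a {..<m} z - partial a {..<n} z) = partial a {n..<m}" by auto
    then show ?thesis by (simp add: hnorm_partial)
  qed
  have diff': "hnorm ip (\<lambda>z. partial a {..<n} z - partial a {..<m} z) =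
      hnorm ip (\<lambda>z. partial a {..<m} z - partial a {..<n} z)" for m n
    by (simp add: hnorm_def ip_diff ip_diff_right partial_mem diff_mem)
  have Cauchy: "\<forall>\<epsilon>>0. \<exists>N. \<forall>m\<ge>N. \<forall>n\<ge>N. hnorm ip (\<lambda>z. partial a {..<m} z - partial a {..<n} z) < \<epsilon>"
  proof (intro allI impI)
    fix \<epsilon> :: real assume "\<epsilon> > 0"
    then obtain N where N: "\<And>m n. m \<ge> N \<Longrightarrow> norm (sum ?t {m..<n}) < \<epsilon>\<^sup>2"
      using sm unfolding summable_Cauchy by (metis zero_less_power)
    have *: "hnorm ip (\<lambda>z. partial a {..<m} z - partial a {..<n} z) < \<epsilon>" if "N \<le> n" "n \<le> m" for m n
    proof -
      have "sqrt (sum ?t {n..<m}) < sqrt (\<epsilon>\<^sup>2)"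
        using N[of n m] that by (intro real_sqrt_less_mono) (simp add: abs_less_iff)
      then show ?thesis using \<open>\<epsilon> > 0\<close> by (simp only: diff[OF that(2)] real_sqrt_abs abs_of_pos)
    qed
    show "\<exists>N. \<forall>m\<ge>N. \<forall>n\<ge>N. hnorm ip (\<lambda>z. partial a {..<m} z - partial a {..<n} z) < \<epsilon>"
      using * diff' by (intro exI[of _ N]) (metis nat_le_linear)
  qed
  obtain g where g: "g \<in> H" and lim: "(\<lambda>n. hnorm ip (\<lambda>z. partial a {..<n} z - g z)) \<longlonglongrightarrow> 0"
    using complete[OF partial_mem Cauchy] by blast
  have "ip g (e n) = a n / c n" for n
  proof (rule LIMSEQ_unique)
    show "(\<lambda>N. ip (partial a {..<N}) (e n)) \<longlonglongrightarrow> ip g (e n)"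
      using tendsto_ip[OF partial_mem g e_mem lim] .
    have "eventually (\<lambda>N. ip (partial a {..<N}) (e n) = a n / c n) sequentially"
      using eventually_gt_at_top[of n] by eventually_elim (simp add: ip_partial_e)
    then show "(\<lambda>N. ip (partial a {..<N}) (e n)) \<longlonglongrightarrow> a n / c n"
      by (rule tendsto_eventually)
  qed
  with g lim that show ?thesis by blast
qed

text \<open>Bessel's inequality allows Riesz-Fischer to build a function with the same coefficients
  as \<open>f\<close>; the difference is orthogonal to every monomial and so vanishes.\<close>

lemma monomial_expansion:
  assumes f: "f \<in> H"
  shows "(\<lambda>n. hnorm ip (\<lambda>z. partial (\<lambda>i. ip f (e i) * c i) {..<n} z - f z)) \<longlonglongrightarrow> 0"
proof -
  define a where "a i = ip f (e i) * c i" for i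
  have Bessel: "(\<Sum>i<n. (cmod (a i))\<^sup>2 / c i) \<le> (hnorm ip f)\<^sup>2" for n
  proof -
    let ?p = "partial a {..<n}" and ?Q = "\<Sum>i<n. (cmod (a i))\<^sup>2 / c i"
    have "ip ?p f = (\<Sum>i<n. a i * ip (e i) f)"
      using f by (simp add: ip_partial)
    also have "\<dots> = (\<Sum>i<n. of_real ((cmod (a i))\<^sup>2 / c i))"
    proof (rule sum.cong[OF refl])
      fix i
      show "a i * ip (e i) f = of_real ((cmod (a i))\<^sup>2 / c i)"
        using ip_cnj[OF f e_mem, of i] c_pos[of i]
        by (simp add: a_def complex_norm_square norm_mult power2_eq_square mult_ac del: of_real_mult)
          (simp add: complex_norm_square[symmetric] flip: power2_eq_square)
    qed
    finally have pf: "ip ?p f = of_real ?Q" by simp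
    then have fp: "ip f ?p = of_real ?Q" using ip_cnj[OF partial_mem[of a "{..<n}"] f] by simp
    have "0 \<le> Re (ip (\<lambda>z. f z - ?p z) (\<lambda>z. f z - ?p z))"
      using f by (intro ip_nonneg diff_mem partial_mem)
    also have "\<dots> = (hnorm ip f)\<^sup>2 - ?Q"
      using f pf fp by (simp add: ip_diff ip_diff_right diff_mem partial_mem ip_partial_self ip_self[OF f])
    finally show ?thesis by simp
  qed
  obtain g where g: "g \<in> H" "(\<lambda>n. hnorm ip (\<lambda>z. partial a {..<n} z - g z)) \<longlonglongrightarrow> 0"
      "\<And>n. ip g (e n) = a n / c n"
    using Riesz_Fischer[OF Bessel] by blast
  have "ip (\<lambda>z. f z - g z) (e n) = 0" for n
    using f g c_pos[of n] by (simp add: ip_diff e_mem) (simp add: a_def)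
  then have "(\<lambda>z. f z - g z) = (\<lambda>z. 0)"
    using f g by (intro eq_0_if_orthogonal diff_mem) auto
  then have "f = g" by (auto simp: fun_eq_iff)
  with g(2) show ?thesis by (simp add: a_def[abs_def])
qed

lemma Riesz_representation:
  assumes add: "\<And>f g. f \<in> H \<Longrightarrow> g \<in> H \<Longrightarrow> L (\<lambda>z. f z + g z) = L f + L g"
    and scale: "\<And>k f. f \<in> H \<Longrightarrow> L (\<lambda>z. k * f z) = k * L f"
    and bd: "\<And>f. f \<in> H \<Longrightarrow> cmod (L f) \<le> C * hnorm ip f"
  shows "\<exists>h\<in>H. \<forall>f\<in>H. L f = ip f h"
proof -
  have L0: "L (\<lambda>z. 0) = 0" using scale[OF zero_mem, of 0] by simp
  have Lsum: "L (\<lambda>z. \<Sum>i\<in>I. f i z) = (\<Sum>i\<in>I. L (f i))" if "finite I" "\<And>i. f i \<in> H" for I :: "nat set" and f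
    using that by (induction I) (auto simp: L0 add sum_mem)
  have Lpartial: "L (partial a {..<n}) = (\<Sum>i<n. a i * L (e i))" for a n
    unfolding partial_def by (simp add: Lsum scale_mem e_mem scale)
  \<comment> \<open>The only coefficients for which the represented functional agrees with
    \<open>L\<close> on the monomials.\<close>
  define a where "a i = cnj (L (e i)) * c i" for i
  have "(\<Sum>i<n. (cmod (a i))\<^sup>2 / c i) \<le> C\<^sup>2" for n
  proof -
    let ?Q = "\<Sum>i<n. (cmod (a i))\<^sup>2 / c i"
    have Q0: "?Q \<ge> 0" using less_imp_le[OF c_pos] by (intro sum_nonneg) simp
    have "a i * L (e i) = of_real ((cmod (a i))\<^sup>2 / c i)" for i
      using c_pos[of i]
      using complex_norm_square[of "L (e i)"]
      by (simp add: a_def norm_mult power_mult_distrib power2_eq_square mult_ac)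
    then have "L (partial a {..<n}) = of_real ?Q"
      by (simp add: Lpartial)
    \<comment> \<open>The bound on \<open>L\<close> is tested on the partial sum itself, whose norm
      is \<open>sqrt ?Q\<close>; this self-improves to a bound independent of
      \<open>n\<close>.\<close>
    then have "?Q \<le> C * sqrt ?Q"
      using bd[OF partial_mem[of a "{..<n}"]] Q0
      by (simp only: hnorm_partial finite_lessThan norm_of_real abs_of_nonneg)
    moreover have "x\<^sup>2 \<le> C\<^sup>2" if "0 \<le> x" "x\<^sup>2 \<le> C * x" for x
    proof (cases "x = 0")
      case False
      with that have "x \<le> C" by (simp add: power2_eq_square)
      with that(1) show ?thesis by (intro power_mono)
    qed simp
    ultimately show ?thesis using Q0 by (metis real_sqrt_ge_zero real_sqrt_pow2)
  qed
  then obtain h where h: "h \<in> H" "\<And>n. ip h (e n) = a n / c n"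
    using Riesz_Fischer by blast
  have he: "ip (e n) h = L (e n)" for n
    using ip_cnj[OF h(1) e_mem, of n] h(2)[of n] c_pos[of n] by (simp add: a_def)
  have "L f = ip f h" if f: "f \<in> H" for f
  proof (rule LIMSEQ_unique)
    let ?p = "\<lambda>n. partial (\<lambda>i. ip f (e i) * c i) {..<n}"
    note lim = monomial_expansion[OF f]
    show "(\<lambda>n. ip (?p n) h) \<longlonglongrightarrow> ip f h"
      using tendsto_ip[OF partial_mem f h(1) lim] .
    show "(\<lambda>n. ip (?p n) h) \<longlonglongrightarrow> L f"
    proof (rule LIM_zero_cancel, rule Lim_null_comparison)
      have Ldiff: "L (\<lambda>z. ?p n z - f z) = L (?p n) - L f" for n
        using add[OF partial_mem scale_mem[OF f, of "-1"]] scale[OF f, of "-1"] by simp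
      have "ip (?p n) h = L (?p n)" for n
        using h(1) by (simp add: ip_partial he Lpartial)
      then have "norm (ip (?p n) h - L f) \<le> C * hnorm ip (\<lambda>z. ?p n z - f z)" for n
        using bd[OF diff_mem[OF partial_mem f]] by (simp only: Ldiff[symmetric])
      then show "\<forall>\<^sub>F n in sequentially. norm (ip (?p n) h - L f) \<le> C * hnorm ip (\<lambda>z. ?p n z - f z)"
        by (rule always_eventually[OF allI])
      show "(\<lambda>n. C * hnorm ip (\<lambda>z. ?p n z - f z)) \<longlonglongrightarrow> 0"
        using tendsto_mult_left[OF lim, of C] by simp
    qed
  qed
  with h(1) show ?thesis by blast
qed

section \<open>Reproducing kernels as power series in \<open>cnj w * z\<close>\<close>

abbreviation "K \<equiv> rep_kernel H ip"

lemma rep_kernel_unique: "k \<in> H \<Longrightarrow> (\<And>f. f \<in> H \<Longrightarrow> f w = ip f k) \<Longrightarrow> K w = k"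
  unfolding rep_kernel_def by (rule the_equality) (auto intro: eq_if_ip_eq)

lemma rep_kernel:
  assumes "w \<in> unit_disk"
  shows rep_kernel_mem: "K w \<in> H" and reproducing: "f \<in> H \<Longrightarrow> f w = ip f (K w)"
proof -
  obtain C where "\<forall>f\<in>H. cmod (f w) \<le> C * hnorm ip f"
    using bounded_eval[OF assms] by blast
  then obtain k where k: "k \<in> H" "\<And>f. f \<in> H \<Longrightarrow> f w = ip f k"
    using Riesz_representation[of "\<lambda>f. f w" C] by auto
  then have "K w = k" by (rule rep_kernel_unique)
  with k show "K w \<in> H" "f \<in> H \<Longrightarrow> f w = ip f (K w)" by auto
qed

lemma hnorm_rep_kernel: "w \<in> unit_disk \<Longrightarrow> (hnorm ip (K w))\<^sup>2 = Re (K w w)"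
  using reproducing[of w "K w"] rep_kernel_mem[of w] by (simp add: ip_self)

text \<open>The monomial expansion of \<open>K w\<close> converges in norm, and pairing it with
  \<open>K z\<close> turns this into convergence at the point \<open>z\<close>.\<close>

lemma rep_kernel_sums:
  assumes w: "w \<in> unit_disk" and z: "z \<in> unit_disk"
  shows "(\<lambda>n. of_real (c n) * (cnj w * z) ^ n) sums K w z"
proof -
  let ?p = "\<lambda>n. partial (\<lambda>i. ip (K w) (e i) * c i) {..<n}"
  have "ip (K w) (e i) = cnj w ^ i" for i
    unfolding ip_cnj[OF e_mem rep_kernel_mem[OF w], of i] reproducing[OF w e_mem, of i, symmetric]
    by (simp add: e_apply[OF w])
  then have "?p n z = (\<Sum>i<n. of_real (c i) * (cnj w * z) ^ i)" for n
    using z by (simp add: partial_def e_apply power_mult_distrib mult_ac)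
  moreover have "(\<lambda>n. ?p n z) \<longlonglongrightarrow> K w z"
    using tendsto_ip[OF partial_mem rep_kernel_mem[OF w] rep_kernel_mem[OF z] monomial_expansion[OF rep_kernel_mem[OF w]]]
    by (simp add: reproducing[OF z, symmetric] partial_mem rep_kernel_mem[OF w])
  ultimately show ?thesis by (simp add: sums_def)
qed

definition k :: "complex \<Rightarrow> complex" where "k x = (\<Sum>n. of_real (c n) * x ^ n)"

lemma rep_kernel_eq: "w \<in> unit_disk \<Longrightarrow> z \<in> unit_disk \<Longrightarrow> K w z = k (cnj w * z)"
  using rep_kernel_sums by (simp add: k_def sums_iff)

lemma c_0: "c 0 = 1"
proof -
  have "(\<lambda>n. of_real (c n) * 0 ^ n) sums (1 :: complex)"
    using rep_kernel_sums[of 0 0] kernel_at_0[of 0] by simp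
  then show ?thesis by simp
qed

lemma k_sums:
  assumes "x \<in> unit_disk"
  shows "(\<lambda>n. of_real (c n) * x ^ n) sums k x"
proof -
  obtain w z where "w \<in> unit_disk" "z \<in> unit_disk" "x = cnj w * z"
    using assms by (rule disk_factor)
  then have "summable (\<lambda>n. of_real (c n) * x ^ n)"
    using rep_kernel_sums by (auto simp: sums_iff)
  then show ?thesis by (simp add: k_def summable_sums)
qed

end

subsection \<open>Adjoints of weighted composition operators\<close>

locale bounded_weighted_composition = weighted_hardy_space H ip
  for H :: "cfun set" and ip :: "cfun \<Rightarrow> cfun \<Rightarrow> complex" +
  fixes F \<phi> :: cfun
  assumes F_holomorphic: "F holomorphic_on unit_disk"
    and \<phi>_holomorphic: "\<phi> holomorphic_on unit_disk"
    and \<phi>_maps: "\<phi> ` unit_disk \<subseteq> unit_disk"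
    and bounded: "bounded_operator H ip (weighted_comp F \<phi>)"
begin

abbreviation "W \<equiv> weighted_comp F \<phi>"

abbreviation "A \<equiv> hilbert_adjoint H ip W"

lemma \<phi>_mem: "z \<in> unit_disk \<Longrightarrow> \<phi> z \<in> unit_disk"
  using \<phi>_maps by blast

lemma W_mem: "f \<in> H \<Longrightarrow> W f \<in> H"
  using bounded unfolding bounded_operator_def by blast

lemma W_apply: "z \<in> unit_disk \<Longrightarrow> W f z = F z * f (\<phi> z)"
  by (simp add: weighted_comp_def on_disk_def)

lemma hilbert_adjoint_unique:
  "h \<in> H \<Longrightarrow> (\<And>f. f \<in> H \<Longrightarrow> ip (W f) g = ip f h) \<Longrightarrow> A g = h"
  unfolding hilbert_adjoint_def by (rule the_equality) (auto intro: eq_if_ip_eq)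

text \<open>For fixed \<open>g\<close> the functional sending \<open>f\<close> to
  \<open>ip (W f) g\<close> is bounded by Cauchy-Schwarz, so Riesz representation justifies the
  definite description of the adjoint.\<close>

lemma hilbert_adjoint:
  assumes g: "g \<in> H"
  shows hilbert_adjoint_mem: "A g \<in> H" and ip_hilbert_adjoint: "f \<in> H \<Longrightarrow> ip (W f) g = ip f (A g)"
proof -
  obtain C where C: "\<And>f. f \<in> H \<Longrightarrow> hnorm ip (W f) \<le> C * hnorm ip f"
    using bounded unfolding bounded_operator_def by blast
  have "\<exists>h\<in>H. \<forall>f\<in>H. ip (W f) g = ip f h"
  proof (rule Riesz_representation)
    show "ip (W (\<lambda>z. f1 z + f2 z)) g = ip (W f1) g + ip (W f2) g" if "f1 \<in> H" "f2 \<in> H" for f1 f2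
    proof -
      have "W (\<lambda>z. f1 z + f2 z) = (\<lambda>z. W f1 z + W f2 z)"
        using bounded that by (simp add: bounded_operator_def)
      then show ?thesis by (simp only: ip_add[OF W_mem[OF that(1)] W_mem[OF that(2)] g])
    qed
    show "ip (W (\<lambda>z. a * f z)) g = a * ip (W f) g" if "f \<in> H" for a f
    proof -
      have "W (\<lambda>z. a * f z) = (\<lambda>z. a * W f z)"
        using bounded that by (simp add: bounded_operator_def)
      then show ?thesis by (simp only: ip_scale[OF W_mem[OF that] g])
    qed
    show "cmod (ip (W f) g) \<le> (C * hnorm ip g) * hnorm ip f" if "f \<in> H" for f
    proof -
      have "cmod (ip (W f) g) \<le> hnorm ip (W f) * hnorm ip g"
        by (rule Cauchy_Schwarz[OF W_mem[OF that] g])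
      also have "\<dots> \<le> C * hnorm ip f * hnorm ip g"
        using C[OF that] hnorm_nonneg[OF g] by (rule mult_right_mono)
      finally show ?thesis by (simp add: mult_ac)
    qed
  qed
  then obtain h where h: "h \<in> H" "\<And>f. f \<in> H \<Longrightarrow> ip (W f) g = ip f h" by blast
  moreover have "A g = h" by (rule hilbert_adjoint_unique) (fact h)+
  ultimately show "A g \<in> H" "f \<in> H \<Longrightarrow> ip (W f) g = ip f (A g)" by auto
qed

lemma hilbert_adjoint_rep_kernel:
  assumes w: "w \<in> unit_disk"
  shows "A (K w) = (\<lambda>z. cnj (F w) * K (\<phi> w) z)"
proof (rule hilbert_adjoint_unique)
  note K\<phi> = rep_kernel_mem[OF \<phi>_mem[OF w]]
  show "(\<lambda>z. cnj (F w) * K (\<phi> w) z) \<in> H" by (rule scale_mem[OF K\<phi>])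
  fix f assume f: "f \<in> H"
  have "ip (W f) (K w) = F w * f (\<phi> w)"
    unfolding reproducing[OF w W_mem[OF f], symmetric] by (rule W_apply[OF w])
  also have "\<dots> = ip f (\<lambda>z. cnj (F w) * K (\<phi> w) z)"
    unfolding ip_scale_right[OF K\<phi> f] reproducing[OF \<phi>_mem[OF w] f] by simp
  finally show "ip (W f) (K w) = ip f (\<lambda>z. cnj (F w) * K (\<phi> w) z)" .
qed

lemma W_hilbert_adjoint_rep_kernel:
  assumes "w \<in> unit_disk" "z \<in> unit_disk"
  shows "W (A (K w)) z = cnj (F w) * F z * k (cnj (\<phi> w) * \<phi> z)"
  unfolding hilbert_adjoint_rep_kernel[OF assms(1)] W_apply[OF assms(2)]
    rep_kernel_eq[OF \<phi>_mem[OF assms(1)] \<phi>_mem[OF assms(2)]]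
  by simp

text \<open>The composite of \<open>W\<close> with its adjoint is self-adjoint, so its values on any
  \<open>f\<close> are determined by its action on the kernels. This extends the identity from
  kernels to all of \<open>H\<close> without a density argument.\<close>

lemma W_hilbert_adjoint_apply:
  assumes f: "f \<in> H" and z: "z \<in> unit_disk"
  shows "W (A f) z = cnj (ip (W (A (K z))) f)"
proof -
  note Kz = rep_kernel_mem[OF z]
  note WAf = W_mem[OF hilbert_adjoint_mem[OF f]] and AK = hilbert_adjoint_mem[OF Kz]
  have "W (A f) z = ip (W (A f)) (K z)" by (rule reproducing[OF z WAf])
  also have "\<dots> = ip (A f) (A (K z))" by (rule ip_hilbert_adjoint[OF Kz hilbert_adjoint_mem[OF f]])
  also have "\<dots> = cnj (ip (A (K z)) (A f))" by (rule ip_cnj[OF AK hilbert_adjoint_mem[OF f]])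
  also have "ip (A (K z)) (A f) = ip (W (A (K z))) f" by (rule ip_hilbert_adjoint[OF f AK, symmetric])
  finally show ?thesis .
qed

lemma co_isometric_iff:
  "co_isometric H ip W \<longleftrightarrow> kernel_identity k F \<phi>"
proof
  assume "co_isometric H ip W"
  then have WA: "W (A (K w)) = K w" if "w \<in> unit_disk" for w
    using rep_kernel_mem[OF that] unfolding co_isometric_def by blast
  have "cnj (F w) * F z * k (cnj (\<phi> w) * \<phi> z) = k (cnj w * z)"
    if w: "w \<in> unit_disk" and z: "z \<in> unit_disk" for w z
    unfolding W_hilbert_adjoint_rep_kernel[OF w z, symmetric] WA[OF w] by (rule rep_kernel_eq[OF w z])
  then show "kernel_identity k F \<phi>"
    unfolding kernel_identity_def by blast
next
  assume id: "kernel_identity k F \<phi>"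
  have WA: "W (A (K w)) = K w" if w: "w \<in> unit_disk" for w
  proof
    fix z
    show "W (A (K w)) z = K w z"
    proof (cases "z \<in> unit_disk")
      case True
      show ?thesis
        unfolding W_hilbert_adjoint_rep_kernel[OF w True] rep_kernel_eq[OF w True]
        using id w True unfolding kernel_identity_def by blast
    next
      case False
      then show ?thesis
        by (simp only: vanish_outside[OF W_mem[OF hilbert_adjoint_mem[OF rep_kernel_mem[OF w]]] False]
            vanish_outside[OF rep_kernel_mem[OF w] False])
    qed
  qed
  have "W (A f) = f" if f: "f \<in> H" for f
  proof
    fix z
    show "W (A f) z = f z"
    proof (cases "z \<in> unit_disk")
      case True
      have "W (A f) z = cnj (ip (K z) f)"
        unfolding W_hilbert_adjoint_apply[OF f True] WA[OF True] ..
      also have "\<dots> = ip f (K z)" by (rule ip_cnj[OF rep_kernel_mem[OF True] f, symmetric])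
      also have "\<dots> = f z" by (rule reproducing[OF True f, symmetric])
      finally show ?thesis .
    next
      case False
      then show ?thesis
        by (simp only: vanish_outside[OF W_mem[OF hilbert_adjoint_mem[OF f]] False] vanish_outside[OF f False])
    qed
  qed
  then show "co_isometric H ip W" by (simp add: co_isometric_def)
qed

text \<open>The range of a co-isometric operator contains \<open>1\<close> and \<open>z\<close>, and
  \<open>z = (F (g \<circ> \<phi>)) / (F (f \<circ> \<phi>))\<close> is recovered from \<open>\<phi> z\<close>.\<close>

lemma inj_on_if_surj:
  assumes "\<And>f. f \<in> H \<Longrightarrow> \<exists>g\<in>H. W g = f"
  shows "inj_on \<phi> unit_disk"
proof
  fix x y assume x: "x \<in> unit_disk" and y: "y \<in> unit_disk" and xy: "\<phi> x = \<phi> y"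
  obtain f g where f: "W f = e 0" and g: "W g = e 1" using assms[OF e_mem] by metis
  have f': "F z * f (\<phi> z) = 1" and g': "F z * g (\<phi> z) = z" if "z \<in> unit_disk" for z
    using W_apply[OF that, of f] W_apply[OF that, of g] e_apply[OF that, of 0] e_apply[OF that, of 1]
    unfolding f g by auto
  have "z * f (\<phi> z) = g (\<phi> z)" "f (\<phi> z) \<noteq> 0" if "z \<in> unit_disk" for z
    using f'[OF that] g'[OF that] by (auto, metis mult.assoc mult.commute mult.right_neutral)
  then show "x = y" using x y xy by (metis mult_right_cancel)
qed

lemma F_nonzero_if_surj:
  assumes "\<And>f. f \<in> H \<Longrightarrow> \<exists>g\<in>H. W g = f" and z: "z \<in> unit_disk"
  shows "F z \<noteq> 0"
proof -
  obtain g where "W g = e 0" using assms(1)[OF e_mem] by blast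
  then show ?thesis using W_apply[OF z, of g] e_apply[OF z, of 0] by auto
qed

text \<open>Since \<open>F\<close> has no zeros, \<open>f\<close> and \<open>g\<close> agree on the
  range of \<open>\<phi>\<close>. Injectivity of \<open>\<phi>\<close> makes that range open, and
  the identity theorem applies.\<close>

lemma inj_W_if_surj:
  assumes surj: "\<And>f. f \<in> H \<Longrightarrow> \<exists>g\<in>H. W g = f"
    and f: "f \<in> H" and g: "g \<in> H" and eq: "W f = W g"
  shows "f = g"
proof
  fix x
  show "f x = g x"
  proof (cases "x \<in> unit_disk")
    case True
    have \<open>open (\<phi> ` unit_disk)\<close>
      using \<phi>_holomorphic inj_on_if_surj[OF surj] by (intro open_mapping_thm3) auto
    moreover have "\<phi> 0 \<in> \<phi> ` unit_disk" by auto
    ultimately have lim: "\<phi> 0 islimpt \<phi> ` unit_disk" by (simp add: interior_limit_point interior_open)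
    have "f x - g x = 0"
    proof (rule analytic_continuation[where S = unit_disk and U = "\<phi> ` unit_disk" and f = "\<lambda>z. f z - g z"])
      show "(\<lambda>z. f z - g z) holomorphic_on unit_disk"
        by (intro holomorphic_intros analytic f g)
      show "f u - g u = 0" if "u \<in> \<phi> ` unit_disk" for u
      proof -
        from that obtain z where z: "z \<in> unit_disk" "u = \<phi> z" by blast
        have "F z * f (\<phi> z) = F z * g (\<phi> z)"
          using eq unfolding W_apply[OF z(1), symmetric] by simp
        then show ?thesis using F_nonzero_if_surj[OF surj z(1)] z by simp
      qed
    qed (use lim \<phi>_maps \<phi>_mem[of 0] True in auto)
    then show ?thesis by simp
  qed (simp add: vanish_outside[OF f] vanish_outside[OF g])
qed

text \<open>A co-isometric \<open>W\<close> sends both \<open>A (W f)\<close> and \<open>f\<close>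
  to \<open>W f\<close>, and injectivity of \<open>W\<close> identifies them.\<close>

lemma unitary_iff_co_isometric: "unitary_operator H ip W \<longleftrightarrow> co_isometric H ip W"
proof
  assume co: "co_isometric H ip W"
  then have WA: "W (A f) = f" if "f \<in> H" for f
    using that unfolding co_isometric_def by blast
  then have surj: "\<exists>g\<in>H. W g = f" if "f \<in> H" for f
    using hilbert_adjoint_mem that by blast
  have "A (W f) = f" if f: "f \<in> H" for f
    by (rule inj_W_if_surj[OF surj hilbert_adjoint_mem[OF W_mem[OF f]] f WA[OF W_mem[OF f]]])
  with WA show "unitary_operator H ip W" unfolding unitary_operator_def by blast
qed (auto simp only: unitary_operator_def co_isometric_def)

end

subsection \<open>The kernel identity\<close>

lemma DERIV_unique_on_open:
  fixes f g :: "complex \<Rightarrow> complex"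
  assumes "(f has_field_derivative a) (at x)" "(g has_field_derivative b) (at x)"
    and "open S" "x \<in> S" "\<And>y. y \<in> S \<Longrightarrow> f y = g y"
  shows "a = b"
  using has_field_derivative_transform_within_open[OF assms(1,3-5)] assms(2)
  by (rule DERIV_unique)

lemma zero_on_disk_if_mult_zero:
  assumes f: "f holomorphic_on unit_disk" and "\<And>x. x \<in> unit_disk \<Longrightarrow> x * f x = 0"
    and x: "x \<in> unit_disk"
  shows "f x = 0"
proof (rule analytic_continuation[OF f, where U = "unit_disk - {0}" and \<xi> = 0])
  show "(0::complex) islimpt unit_disk - {0}"
    by (simp add: islimpt_punctured[symmetric] interior_limit_point)
  show "f z = 0" if "z \<in> unit_disk - {0}" for z using assms(2)[of z] that by simp
qed (use x in auto)

text \<open>A slope \<open>0 < \<sigma> < 1\<close> in \<open>(1 - \<sigma> x) k' = \<gamma> k\<close> would make \<open>\<phi>\<close> an automorphism of the disk of radius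
  \<open>1 / sqrt \<sigma> > 1\<close> moving \<open>0\<close>, which cannot map the unit disk into itself.\<close>

lemma slope_ge_1:
  fixes \<beta> \<sigma> :: real
  assumes \<beta>: "0 < \<beta>" "\<beta> < 1"
    and lt: "\<And>t. 0 \<le> t \<Longrightarrow> t < 1 \<Longrightarrow> t + \<beta> < \<bar>1 + \<sigma> * \<beta> * t\<bar>"
  shows "\<sigma> \<ge> 1"
proof (rule ccontr)
  assume "\<not> \<sigma> \<ge> 1"
  then have \<sigma>\<beta>: "\<sigma> * \<beta> < \<beta>" using \<beta> by simp
  show False
  proof (cases "\<sigma> * \<beta> < -1")
    case True
    \<comment> \<open>Here the right-hand side of \<open>lt\<close> vanishes.\<close>
    define t where "t = - inverse (\<sigma> * \<beta>)"
    have t: "0 \<le> t" "t < 1" "1 + \<sigma> * \<beta> * t = 0"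
      using True by (auto simp: t_def divide_simps inverse_eq_divide)
    then show False using lt[of t] \<beta> by simp
  next
    case False
    \<comment> \<open>The solution of \<open>t + \<beta> = 1 + \<sigma> * \<beta> * t\<close>, where
      the strict inequality degenerates; it is below 1 because
      \<open>\<sigma> * \<beta> < \<beta>\<close>.\<close>
    define t where "t = (1 - \<beta>) / (1 - \<sigma> * \<beta>)"
    have pos: "1 - \<sigma> * \<beta> > 0" using \<sigma>\<beta> \<beta> by linarith
    have t: "0 \<le> t" "t < 1" using \<sigma>\<beta> \<beta> pos by (simp_all add: t_def divide_simps)
    have "t * (1 - \<sigma> * \<beta>) = 1 - \<beta>" using pos by (simp add: t_def)
    then have eq: "t + \<beta> = 1 + \<sigma> * \<beta> * t" by (simp add: algebra_simps)
    have "1 + \<sigma> * \<beta> * t > 0" using eq t \<beta> by linarith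
    then show False using lt[OF t] eq by simp
  qed
qed

text \<open>Collects what positivity of the Taylor coefficients contributes: a positive slope at 0,
  real values on the real axis, and growth on [0,1), which excludes zeros there.\<close>

locale positive_kernel =
  fixes k :: cfun and \<gamma> :: real
  assumes k_holomorphic: "k holomorphic_on unit_disk"
    and k_0: "k 0 = 1"
    and deriv_k_0: "deriv k 0 = of_real \<gamma>"
    and \<gamma>_pos: "\<gamma> > 0"
    and cnj_k: "x \<in> unit_disk \<Longrightarrow> cnj (k x) = k (cnj x)"
    and k_mono: "strict_mono_on {0..<1} (\<lambda>x. Re (k (of_real x)))"
begin

lemma k_of_real:
  assumes "0 \<le> x" "x < 1"
  shows "k (of_real x) = of_real (Re (k (of_real x)))" and "Re (k (of_real x)) \<ge> 1"
    and "k (of_real x) \<noteq> 0"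
proof -
  have "cnj (k (of_real x)) = k (of_real x)" using cnj_k[of "of_real x"] assms by simp
  then show "k (of_real x) = of_real (Re (k (of_real x)))" by (simp add: complex_eq_iff)
  show "Re (k (of_real x)) \<ge> 1"
    using strict_mono_onD[OF k_mono, of 0 x] assms k_0 by (cases "x = 0") auto
  then show "k (of_real x) \<noteq> 0" by auto
qed

lemma DERIV_k:
  assumes "(f has_field_derivative f') (at x)" "f x \<in> unit_disk"
  shows "((\<lambda>x. k (f x)) has_field_derivative deriv k (f x) * f') (at x)"
  by (rule DERIV_chain2[OF holomorphic_derivI[OF k_holomorphic] assms(1)]) (use assms in auto)

lemma deriv_k_holomorphic: "deriv k holomorphic_on unit_disk"
  by (rule holomorphic_deriv[OF k_holomorphic]) simp

lemma DERIV_deriv_k: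
  assumes "(f has_field_derivative f') (at x)" "f x \<in> unit_disk"
  shows "((\<lambda>x. deriv k (f x)) has_field_derivative deriv (deriv k) (f x) * f') (at x)"
  by (rule DERIV_chain2[OF holomorphic_derivI[OF deriv_k_holomorphic] assms(1)]) (use assms in auto)

lemma k_eq_powr:
  assumes ode: "\<And>x. x \<in> unit_disk \<Longrightarrow> (1 - x) * deriv k x = of_real \<gamma> * k x" and x: "x \<in> unit_disk"
  shows "k x = (1 - x) powr (- of_real \<gamma>)"
proof -
  \<comment> \<open>The quotient of \<open>k\<close> by the expected solution; the differential
    equation says that its derivative vanishes.\<close>
  let ?h = "\<lambda>x. k x * exp (of_real \<gamma> * Ln (1 - x))"
  have "\<exists>c. \<forall>x\<in>unit_disk. ?h x = c"
  proof (rule has_field_derivative_zero_constant)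
    fix x :: complex assume x: "x \<in> unit_disk"
    then have Re: "Re (1 - x) > 0" using complex_Re_le_cmod[of x] by simp
    then have nz: "1 - x \<noteq> 0" by force
    have "1 - x \<notin> \<real>\<^sub>\<le>\<^sub>0" using Re by (auto simp: complex_nonpos_Reals_iff)
    then have "(?h has_field_derivative
        (deriv k x - k x * of_real \<gamma> / (1 - x)) * exp (of_real \<gamma> * Ln (1 - x))) (at x)"
      using x by (auto intro!: derivative_eq_intros DERIV_k simp: algebra_simps divide_inverse)
    moreover have "deriv k x - k x * of_real \<gamma> / (1 - x) = 0"
      using ode[OF x] nz by (simp add: field_simps)
    ultimately show "(?h has_field_derivative 0) (at x within unit_disk)"
      by (simp add: has_field_derivative_at_within)
  qed simp
  then have "?h x = ?h 0" using x by (metis centre_in_ball zero_less_one)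
  then have "k x * exp (of_real \<gamma> * Ln (1 - x)) = 1" using k_0 by simp
  moreover have "1 - x \<noteq> 0" using x by auto
  ultimately show ?thesis by (simp add: powr_def exp_minus field_simps)
qed

end

locale kernel_symbol = positive_kernel +
  fixes F \<phi> :: cfun
  assumes \<phi>_holomorphic: "\<phi> holomorphic_on unit_disk"
    and \<phi>_mem: "z \<in> unit_disk \<Longrightarrow> \<phi> z \<in> unit_disk"
    and kernel_id: "kernel_identity k F \<phi>"
begin

lemma cnj_mem: "x \<in> unit_disk \<Longrightarrow> cnj x \<in> unit_disk"
  by simp

lemma identity:
  "w \<in> unit_disk \<Longrightarrow> z \<in> unit_disk \<Longrightarrow> cnj (F w) * F z * k (cnj (\<phi> w) * \<phi> z) = k (cnj w * z)"
  using kernel_id unfolding kernel_identity_def by blast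

lemma identity_0: "z \<in> unit_disk \<Longrightarrow> cnj (F 0) * F z * k (cnj (\<phi> 0) * \<phi> z) = 1"
  using identity[of 0 z] k_0 by simp

lemma rotation_if_fixes_0:
  assumes 0: "\<phi> 0 = 0"
  shows "rotation \<phi>" and "\<exists>c. cmod c = 1 \<and> (\<forall>z\<in>unit_disk. F z = c)"
proof -
  have F: "cnj (F 0) * F z = 1" if "z \<in> unit_disk" for z
    using identity_0[OF that] 0 k_0 by simp
  then have F0: "cnj (F 0) * F 0 = 1" by simp
  have "cnj (F 0) \<noteq> 0" using F0 by auto
  then have const: "F z = F 0" if "z \<in> unit_disk" for z
    using F[OF that] F0 by (metis mult_left_cancel)
  have "(cmod (F 0))\<^sup>2 = 1"
    using F0 by (metis complex_norm_square mult.commute of_real_eq_1_iff)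
  then have "cmod (F 0) = 1"
    using norm_ge_zero by (metis power2_eq_1_iff le_minus_one_simps(3))
  with const show "\<exists>c. cmod c = 1 \<and> (\<forall>z\<in>unit_disk. F z = c)" by blast
  \<comment> \<open>On the diagonal \<open>w = z\<close> the identity compares \<open>k\<close> at
    the two squared moduli, and strict monotonicity makes \<open>k\<close> injective on
    [0,1).\<close>
  have norm: "cmod (\<phi> z) = cmod z" if z: "z \<in> unit_disk" for z
  proof -
    let ?f = "\<lambda>x. Re (k (of_real x))"
    have "k (cnj (\<phi> z) * \<phi> z) = k (cnj z * z)"
      using identity[OF z z] F0 unfolding const[OF z] by simp
    then have "?f ((cmod (\<phi> z))\<^sup>2) = ?f ((cmod z)\<^sup>2)"
      by (simp only: complex_norm_square mult.commute)
    moreover have "(cmod (\<phi> z))\<^sup>2 \<in> {0..<1}" "(cmod z)\<^sup>2 \<in> {0..<1}"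
      using z \<phi>_mem[OF z] by (auto simp: power_less_one_iff)
    ultimately have "(cmod (\<phi> z))\<^sup>2 = (cmod z)\<^sup>2"
      by (rule inj_onD[OF strict_mono_on_imp_inj_on[OF k_mono]])
    then show ?thesis by simp
  qed
  have lt: "norm (\<phi> z) < 1" if "norm z < 1" for z using \<phi>_mem[of z] that by simp
  have half: "norm (1/2 :: complex) < 1" by (simp add: norm_divide)
  have "\<exists>\<alpha>. (\<forall>z. norm z < 1 \<longrightarrow> \<phi> z = \<alpha> * z) \<and> norm \<alpha> = 1"
    using Schwarz_Lemma(3)[OF \<phi>_holomorphic 0 lt half] norm[of "1/2"] half
    by (metis divide_eq_0_iff mem_ball_0 zero_neq_numeral zero_neq_one)
  then show "rotation \<phi>" by (auto simp: rotation_def)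
qed

text \<open>\<open>F\<close> is eliminated: the identity with one argument equal to 0 supplies three
  factors equal to 1, which absorb \<open>cnj (F w) * F z\<close>.\<close>

lemma normalized_identity:
  assumes w: "w \<in> unit_disk" and z: "z \<in> unit_disk"
  shows "k (\<phi> 0 * cnj (\<phi> 0)) * k (cnj (\<phi> w) * \<phi> z) =
    k (cnj w * z) * k (cnj (\<phi> 0) * \<phi> z) * k (\<phi> 0 * cnj (\<phi> w))"
proof -
  have 0: "(0::complex) \<in> unit_disk" by simp
  have 1: "cnj (F 0) * F 0 * k (\<phi> 0 * cnj (\<phi> 0)) = 1"
    using identity_0[OF 0] by (simp add: mult.commute)
  have 2: "cnj (F 0) * F z * k (cnj (\<phi> 0) * \<phi> z) = 1" using identity_0[OF z] .
  have "cnj (k (cnj (\<phi> 0) * \<phi> w)) = k (\<phi> 0 * cnj (\<phi> w))"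
    using cnj_k[OF disk_mult_mem[OF cnj_mem[OF \<phi>_mem[OF 0]] \<phi>_mem[OF w]]] by simp
  then have 3: "F 0 * cnj (F w) * k (\<phi> 0 * cnj (\<phi> w)) = 1"
    using arg_cong[OF identity_0[OF w], of cnj] by simp
  have "k (\<phi> 0 * cnj (\<phi> 0)) * k (cnj (\<phi> w) * \<phi> z) =
    k (\<phi> 0 * cnj (\<phi> 0)) * k (cnj (\<phi> w) * \<phi> z) * (cnj (F 0) * F z * k (cnj (\<phi> 0) * \<phi> z))
      * (F 0 * cnj (F w) * k (\<phi> 0 * cnj (\<phi> w)))"
    by (simp only: 2 3 mult_1_right)
  also have "\<dots> = (cnj (F 0) * F 0 * k (\<phi> 0 * cnj (\<phi> 0))) *
     (cnj (F w) * F z * k (cnj (\<phi> w) * \<phi> z)) * k (cnj (\<phi> 0) * \<phi> z) * k (\<phi> 0 * cnj (\<phi> w))"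
    by (simp only: mult_ac)
  finally show ?thesis by (simp only: 1 identity[OF w z] mult_1_left)
qed

end

section \<open>The case where the symbol moves the origin\<close>

locale kernel_symbol_moving = kernel_symbol +
  assumes moving: "\<phi> 0 \<noteq> 0"
begin

abbreviation "b \<equiv> \<phi> 0"

abbreviation "k' \<equiv> deriv k"

abbreviation "k'' \<equiv> deriv (deriv k)"

text \<open>The reflected symbol, holomorphic in \<open>x = cnj w\<close>, through which the
  identity can be differentiated in its first variable.\<close>

definition \<psi> :: cfun where "\<psi> = (\<lambda>x. cnj (\<phi> (cnj x)))"

lemma b_mem: "b \<in> unit_disk" "cnj b \<in> unit_disk"
  using \<phi>_mem[of 0] by auto

lemma \<psi>_mem: "x \<in> unit_disk \<Longrightarrow> \<psi> x \<in> unit_disk"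
  using \<phi>_mem[of "cnj x"] by (simp add: \<psi>_def)

lemma \<psi>_0: "\<psi> 0 = cnj b"
  by (simp add: \<psi>_def)

lemma DERIV_\<psi>_cnj:
  assumes "x \<in> unit_disk"
  shows "(\<psi> has_field_derivative cnj (deriv \<phi> (cnj x))) (at x)"
  unfolding \<psi>_def
  using has_field_derivative_cnj_cnj[OF holomorphic_derivI[OF \<phi>_holomorphic open_ball, of "cnj x"]] assms
  by (simp add: o_def)

lemma \<psi>_holomorphic: "\<psi> holomorphic_on unit_disk"
  unfolding holomorphic_on_open[OF open_ball] using DERIV_\<psi>_cnj by blast

lemma DERIV_\<psi>: "x \<in> unit_disk \<Longrightarrow> (\<psi> has_field_derivative deriv \<psi> x) (at x)"
  by (rule holomorphic_derivI[OF \<psi>_holomorphic]) auto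

lemma DERIV_deriv_\<psi>: "x \<in> unit_disk \<Longrightarrow> (deriv \<psi> has_field_derivative deriv (deriv \<psi>) x) (at x)"
  by (rule holomorphic_derivI[OF holomorphic_deriv[OF \<psi>_holomorphic]]) auto

lemma deriv_\<phi>_0: "deriv \<phi> 0 = cnj (deriv \<psi> 0)"
  using DERIV_unique[OF DERIV_\<psi>_cnj[of 0] DERIV_\<psi>[of 0]] by (metis centre_in_ball complex_cnj_cnj complex_cnj_zero zero_less_one)

lemma \<psi>_identity:
  assumes "x \<in> unit_disk" "z \<in> unit_disk"
  shows "k (b * cnj b) * k (\<psi> x * \<phi> z) = k (cnj b * \<phi> z) * (k (x * z) * k (b * \<psi> x))"
  using normalized_identity[OF cnj_mem[OF assms(1)] assms(2)] by (simp add: \<psi>_def mult_ac)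

text \<open>Stated for all \<open>x\<close>, not only at 0, so that it can be differentiated once
  more.\<close>

lemma \<psi>_identity_deriv:
  assumes x: "x \<in> unit_disk" and z: "z \<in> unit_disk"
  shows "k (b * cnj b) * (k' (\<psi> x * \<phi> z) * (deriv \<psi> x * \<phi> z)) =
    k (cnj b * \<phi> z) * (k' (x * z) * z * k (b * \<psi> x) + k (x * z) * (k' (b * \<psi> x) * (b * deriv \<psi> x)))"
proof (rule DERIV_unique_on_open[OF _ _ open_ball x \<psi>_identity[OF _ z]])
  show "((\<lambda>x. k (b * cnj b) * k (\<psi> x * \<phi> z)) has_field_derivative
      k (b * cnj b) * (k' (\<psi> x * \<phi> z) * (deriv \<psi> x * \<phi> z))) (at x)"
    by (intro DERIV_cmult DERIV_k DERIV_cmult_right DERIV_\<psi>[OF x] disk_mult_mem \<psi>_mem x \<phi>_mem z)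
  show "((\<lambda>x. k (cnj b * \<phi> z) * (k (x * z) * k (b * \<psi> x))) has_field_derivative
      k (cnj b * \<phi> z) * (k' (x * z) * z * k (b * \<psi> x) + k (x * z) * (k' (b * \<psi> x) * (b * deriv \<psi> x)))) (at x)"
    by (rule derivative_eq_intros DERIV_k DERIV_\<psi> x disk_mult_mem z \<psi>_mem b_mem refl)+ simp
qed

lemma \<psi>_identity_deriv2:
  assumes z: "z \<in> unit_disk"
  shows "k (b * cnj b) * (k'' (cnj b * \<phi> z) * (deriv \<psi> 0 * \<phi> z)\<^sup>2 + k' (cnj b * \<phi> z) * (deriv (deriv \<psi>) 0 * \<phi> z)) =
    k (cnj b * \<phi> z) * (k'' 0 * z\<^sup>2 * k (b * cnj b) + 2 * (k' 0 * z) * (k' (b * cnj b) * (b * deriv \<psi> 0))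
      + (k'' (b * cnj b) * (b * deriv \<psi> 0)\<^sup>2 + k' (b * cnj b) * (b * deriv (deriv \<psi>) 0)))"
proof (rule DERIV_unique_on_open[OF _ _ open_ball _ \<psi>_identity_deriv[OF _ z]])
  show 0: "(0::complex) \<in> unit_disk" by simp
  show "((\<lambda>x. k (b * cnj b) * (k' (\<psi> x * \<phi> z) * (deriv \<psi> x * \<phi> z))) has_field_derivative
      k (b * cnj b) * (k'' (cnj b * \<phi> z) * (deriv \<psi> 0 * \<phi> z)\<^sup>2 + k' (cnj b * \<phi> z) * (deriv (deriv \<psi>) 0 * \<phi> z))) (at 0)"
    by (rule derivative_eq_intros DERIV_deriv_k DERIV_\<psi> DERIV_deriv_\<psi> 0 disk_mult_mem \<phi>_mem z \<psi>_mem refl)+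
      (simp add: \<psi>_0 power2_eq_square algebra_simps)
  show "((\<lambda>x. k (cnj b * \<phi> z) * (k' (x * z) * z * k (b * \<psi> x) + k (x * z) * (k' (b * \<psi> x) * (b * deriv \<psi> x))))
      has_field_derivative k (cnj b * \<phi> z) * (k'' 0 * z\<^sup>2 * k (b * cnj b) + 2 * (k' 0 * z) * (k' (b * cnj b) * (b * deriv \<psi> 0))
      + (k'' (b * cnj b) * (b * deriv \<psi> 0)\<^sup>2 + k' (b * cnj b) * (b * deriv (deriv \<psi>) 0)))) (at 0)"
    by (rule derivative_eq_intros DERIV_k DERIV_deriv_k DERIV_\<psi> DERIV_deriv_\<psi> 0 disk_mult_mem b_mem z \<psi>_mem refl)+
      (simp add: \<psi>_0 k_0 power2_eq_square algebra_simps)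
qed

abbreviation "E \<equiv> deriv \<psi> 0"

lemma real_bb: "b * cnj b = of_real ((cmod b)\<^sup>2)" "(cmod b)\<^sup>2 < 1" "0 < (cmod b)\<^sup>2"
  using b_mem moving complex_norm_square[of b] by (auto simp: power_less_one_iff)

lemma k_bb_nonzero: "k (b * cnj b) \<noteq> 0"
  unfolding real_bb(1) using real_bb(2) by (intro k_of_real) auto

lemma k_b\<phi>_nonzero: "z \<in> unit_disk \<Longrightarrow> k (cnj b * \<phi> z) \<noteq> 0"
  using identity_0[of z] by auto

text \<open>The first derivative at \<open>x = 0\<close>, where \<open>\<psi>\<close> takes the
  value \<open>cnj b\<close>. The bracket is affine in \<open>z\<close> with nonzero slope, so
  \<open>z\<close> can be recovered from \<open>\<phi> z\<close>.\<close>

lemma first_order: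
  assumes "z \<in> unit_disk"
  shows "k (b * cnj b) * E * \<phi> z * k' (cnj b * \<phi> z) =
    k (cnj b * \<phi> z) * (z * of_real \<gamma> * k (b * cnj b) + b * E * k' (b * cnj b))"
  using \<psi>_identity_deriv[OF _ assms, of 0] by (simp add: \<psi>_0 k_0 deriv_k_0 mult_ac)

text \<open>For \<open>E = 0\<close> the left side of \<open>first_order\<close> vanishes
  identically, while the right side is a nonzero multiple of
  \<open>z * k (cnj b * \<phi> z)\<close>.\<close>

lemma E_nonzero: "E \<noteq> 0"
proof
  assume "E = 0"
  moreover have "(1/2::complex) \<in> unit_disk" by (simp add: norm_divide)
  ultimately show False
    using first_order[of "1/2"] k_b\<phi>_nonzero[of "1/2"] k_bb_nonzero \<gamma>_pos by auto
qed

lemma \<phi>_inj: "inj_on \<phi> unit_disk"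
proof
  fix x y assume x: "x \<in> unit_disk" and y: "y \<in> unit_disk" and eq: "\<phi> x = \<phi> y"
  have "k (cnj b * \<phi> y) * (x * of_real \<gamma> * k (b * cnj b) + b * E * k' (b * cnj b)) =
      k (cnj b * \<phi> y) * (y * of_real \<gamma> * k (b * cnj b) + b * E * k' (b * cnj b))"
    by (rule trans[OF sym[OF first_order[OF x, unfolded eq]] first_order[OF y]])
  then show "x = y"
    using k_b\<phi>_nonzero[OF y] k_bb_nonzero \<gamma>_pos by simp
qed

text \<open>\<open>first_order\<close> is solved for \<open>z\<close> and inserted into the
  second-order identity. The relation is homogeneous in \<open>k\<close> and its derivatives, so no
  division by \<open>k\<close> is involved.\<close>

lemma quadratic_relation:
  "\<exists>\<alpha> \<beta> \<delta>. \<forall>x\<in>unit_disk.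
    x\<^sup>2 * k'' x * k x = \<alpha> * (x * k' x)\<^sup>2 + \<beta> * (x * k' x) * k x + \<delta> * (k x)\<^sup>2"
proof -
  define A where "A = k (b * cnj b)"
  define B where "B = k' (b * cnj b)"
  define h where "h = k'' 0"
  define m where "m = cnj b * cnj b * (k'' (b * cnj b) * (b * E)\<^sup>2 + B * (b * deriv (deriv \<psi>) 0))"
  define n where "n = of_real \<gamma> * A * cnj b"
  define p where "p = A * E / n"
  define q where "q = - (b * cnj b * E * B / n)"
  have nz: "A \<noteq> 0" "E \<noteq> 0" "cnj b \<noteq> 0" "n \<noteq> 0"
    using k_bb_nonzero E_nonzero moving \<gamma>_pos by (auto simp: A_def n_def)
  define l where "l = 2 * of_real \<gamma> * (B * b * E) * (cnj b * cnj b)"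
  \<comment> \<open>These three constants arise by comparing the coefficients of
    \<open>P\<^sup>2\<close>, \<open>P * k x\<close> and \<open>(k x)\<^sup>2\<close> after
    substituting \<open>t = p * P + q * k x\<close> in the second-order identity.\<close>
  define \<alpha> where "\<alpha> = h * A * (cnj b * cnj b) * p\<^sup>2 / (A * E\<^sup>2)"
  define \<beta> where "\<beta> = (2 * h * A * (cnj b * cnj b) * p * q + l * p - A * cnj b * deriv (deriv \<psi>) 0) / (A * E\<^sup>2)"
  define \<delta> where "\<delta> = (h * A * (cnj b * cnj b) * q\<^sup>2 + l * q + m) / (A * E\<^sup>2)"
  let ?\<Phi> = "\<lambda>x. x\<^sup>2 * k'' x * k x - (\<alpha> * (x * k' x)\<^sup>2 + \<beta> * (x * k' x) * k x + \<delta> * (k x)\<^sup>2)"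
  have zero: "?\<Phi> (cnj b * \<phi> z) = 0" if z: "z \<in> unit_disk" for z
  proof -
    define x where "x = cnj b * \<phi> z"
    define P where "P = x * k' x"
    \<comment> \<open>Using \<open>z * k x\<close> in place of \<open>z\<close> keeps its expression
      linear in \<open>P\<close> and \<open>k x\<close>.\<close>
    define t where "t = z * k x"
    have "n * t = cnj b * (k x * (z * of_real \<gamma> * A + b * E * B)) - b * cnj b * E * B * k x"
      by (simp add: n_def t_def algebra_simps)
    also have "\<dots> = A * E * P - b * cnj b * E * B * k x"
      unfolding first_order[OF z, folded A_def B_def x_def, symmetric] by (simp add: P_def x_def)
    finally have "n * t = A * E * P - b * cnj b * E * B * k x" .
    then have t: "t = p * P + q * k x"
      using nz by (simp add: p_def q_def field_simps)
    have "A * E\<^sup>2 * (x\<^sup>2 * k'' x * k x) + A * cnj b * deriv (deriv \<psi>) 0 * P * k x =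
      (cnj b * cnj b * k x) * (A * (k'' x * (E * \<phi> z)\<^sup>2 + k' x * (deriv (deriv \<psi>) 0 * \<phi> z)))"
      by (simp add: P_def x_def power2_eq_square algebra_simps)
    also have "\<dots> = (cnj b * cnj b * k x) * (k x * (h * z\<^sup>2 * A + 2 * (of_real \<gamma> * z) * (B * (b * E))
      + (k'' (b * cnj b) * (b * E)\<^sup>2 + B * (b * deriv (deriv \<psi>) 0))))"
      by (simp only: \<psi>_identity_deriv2[OF z, folded A_def B_def h_def x_def] deriv_k_0)
    also have "\<dots> = h * A * (cnj b * cnj b) * t\<^sup>2 + l * t * k x + m * (k x)\<^sup>2"
      by (simp add: t_def l_def m_def power2_eq_square algebra_simps)
    also have "\<dots> = A * E\<^sup>2 * (\<alpha> * P\<^sup>2 + \<beta> * P * k x + \<delta> * (k x)\<^sup>2) + A * cnj b * deriv (deriv \<psi>) 0 * P * k x"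
    proof -
      have \<alpha>: "A * E\<^sup>2 * \<alpha> = h * A * (cnj b * cnj b) * p\<^sup>2"
        and \<beta>: "A * E\<^sup>2 * \<beta> = 2 * h * A * (cnj b * cnj b) * p * q + l * p - A * cnj b * deriv (deriv \<psi>) 0"
        and \<delta>: "A * E\<^sup>2 * \<delta> = h * A * (cnj b * cnj b) * q\<^sup>2 + l * q + m"
        using nz by (simp_all add: \<alpha>_def \<beta>_def \<delta>_def)
      have "A * E\<^sup>2 * (\<alpha> * P\<^sup>2 + \<beta> * P * k x + \<delta> * (k x)\<^sup>2) =
        (A * E\<^sup>2 * \<alpha>) * P\<^sup>2 + (A * E\<^sup>2 * \<beta>) * P * k x + (A * E\<^sup>2 * \<delta>) * (k x)\<^sup>2"
        by (simp only: distrib_left mult.assoc)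
      then show ?thesis
        unfolding \<alpha> \<beta> \<delta> t by (simp add: power2_eq_square algebra_simps)
    qed
    finally show ?thesis
      using nz by (simp flip: x_def P_def)
  qed
  \<comment> \<open>The points \<open>cnj b * \<phi> z\<close> form an open set by injectivity of
    \<open>\<phi>\<close>, so the relation spreads to the disk.\<close>
  have "?\<Phi> x = 0" if x: "x \<in> unit_disk" for x
  proof (rule analytic_continuation[where S = unit_disk and f = ?\<Phi> and U = "(\<lambda>z. cnj b * \<phi> z) ` unit_disk"])
    show "?\<Phi> holomorphic_on unit_disk"
      by (intro holomorphic_intros k_holomorphic deriv_k_holomorphic holomorphic_deriv) auto
    have "open ((\<lambda>z. cnj b * \<phi> z) ` unit_disk)"
    proof (rule open_mapping_thm3)
      show "(\<lambda>z. cnj b * \<phi> z) holomorphic_on unit_disk"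
        by (intro holomorphic_intros \<phi>_holomorphic)
      show "inj_on (\<lambda>z. cnj b * \<phi> z) unit_disk"
        using \<phi>_inj moving by (simp add: inj_on_def)
    qed simp
    moreover have "cnj b * b \<in> (\<lambda>z. cnj b * \<phi> z) ` unit_disk" by auto
    ultimately show "cnj b * b islimpt (\<lambda>z. cnj b * \<phi> z) ` unit_disk"
      by (simp add: interior_limit_point interior_open)
    show "cnj b * b \<in> unit_disk" by (intro disk_mult_mem b_mem)
    show "(\<lambda>z. cnj b * \<phi> z) ` unit_disk \<subseteq> unit_disk" using disk_mult_mem[OF b_mem(2) \<phi>_mem] by blast
  qed (use x zero in auto)
  then show ?thesis by (intro exI[of _ \<alpha>] exI[of _ \<beta>] exI[of _ \<delta>]) simp
qed

text \<open>Setting \<open>x = 0\<close> gives \<open>\<delta> = 0\<close>. After cancelling one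
  factor \<open>x\<close>, the value at 0 is \<open>\<beta> * \<gamma>\<close>, so
  \<open>\<beta> = 0\<close>, and a second factor cancels.\<close>

lemma second_order_ode:
  "\<exists>\<alpha>. \<forall>x\<in>unit_disk. k'' x * k x = \<alpha> * (k' x)\<^sup>2"
proof -
  obtain \<alpha> \<beta> \<delta> where q: "\<And>x. x \<in> unit_disk \<Longrightarrow>
      x\<^sup>2 * k'' x * k x = \<alpha> * (x * k' x)\<^sup>2 + \<beta> * (x * k' x) * k x + \<delta> * (k x)\<^sup>2"
    using quadratic_relation by metis
  have [simp]: "\<delta> = 0" using q[of 0] k_0 by simp
  note hol = k_holomorphic deriv_k_holomorphic holomorphic_deriv
  have 1: "x * (k'' x * k x) - (\<alpha> * x * (k' x)\<^sup>2 + \<beta> * k' x * k x) = 0" if "x \<in> unit_disk" for x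
  proof (rule zero_on_disk_if_mult_zero[OF _ _ that])
    show "(\<lambda>x. x * (k'' x * k x) - (\<alpha> * x * (k' x)\<^sup>2 + \<beta> * k' x * k x)) holomorphic_on unit_disk"
      by (intro holomorphic_intros hol) auto
    show "x * (x * (k'' x * k x) - (\<alpha> * x * (k' x)\<^sup>2 + \<beta> * k' x * k x)) = 0" if "x \<in> unit_disk" for x
      using q[OF that] by (simp add: power2_eq_square algebra_simps)
  qed
  have [simp]: "\<beta> = 0" using 1[of 0] k_0 deriv_k_0 \<gamma>_pos by simp
  have 2: "k'' x * k x - \<alpha> * (k' x)\<^sup>2 = 0" if "x \<in> unit_disk" for x
  proof (rule zero_on_disk_if_mult_zero[OF _ _ that])
    show "(\<lambda>x. k'' x * k x - \<alpha> * (k' x)\<^sup>2) holomorphic_on unit_disk"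
      by (intro holomorphic_intros hol) auto
    show "x * (k'' x * k x - \<alpha> * (k' x)\<^sup>2) = 0" if "x \<in> unit_disk" for x
      using 1[OF that] by (simp add: algebra_simps)
  qed
  then show ?thesis by (intro exI[of _ \<alpha>]) simp
qed

text \<open>The second-order equation says that \<open>k / k'\<close> has constant derivative
  \<open>1 - \<alpha>\<close>; its value at 0 is \<open>1 / \<gamma>\<close>. This integrates near
  0, where \<open>k'\<close> has no zeros, and extends by the identity theorem.\<close>

lemma first_order_ode:
  "\<exists>s. \<forall>x\<in>unit_disk. (1 - s * x) * k' x = of_real \<gamma> * k x"
proof -
  obtain \<alpha> where ode: "\<And>x. x \<in> unit_disk \<Longrightarrow> k'' x * k x = \<alpha> * (k' x)\<^sup>2"
    using second_order_ode by metis
  define s where "s = (\<alpha> - 1) * of_real \<gamma>"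
  have k'0: "k' 0 \<noteq> 0" using deriv_k_0 \<gamma>_pos by simp
  obtain d where d: "d > 0" "\<And>y. dist 0 y < d \<Longrightarrow> k' y \<noteq> 0"
    using continuous_on_open_avoid[OF holomorphic_on_imp_continuous_on[OF deriv_k_holomorphic] open_ball _ k'0]
    by auto
  define r where "r = min d 1"
  have r: "r > 0" "r \<le> 1" and nz: "\<And>x. x \<in> ball 0 r \<Longrightarrow> k' x \<noteq> 0"
    using d by (auto simp: r_def)
  have sub: "ball 0 r \<subseteq> unit_disk" using r by auto
  have "\<exists>c. \<forall>x\<in>ball 0 r. k x / k' x - (1 - \<alpha>) * x = c"
  proof (rule has_field_derivative_zero_constant)
    fix x :: complex assume x: "x \<in> ball 0 r"
    then have xd: "x \<in> unit_disk" using sub by blast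
    have "((\<lambda>x. k x / k' x - (1 - \<alpha>) * x) has_field_derivative
        (k' x * k' x - k x * k'' x) / (k' x * k' x) - (1 - \<alpha>)) (at x)"
      using nz[OF x] by (auto intro!: derivative_eq_intros DERIV_k DERIV_deriv_k xd)
    moreover have "(k' x * k' x - k x * k'' x) / (k' x * k' x) - (1 - \<alpha>) = 0"
      using ode[OF xd] nz[OF x] by (simp add: field_simps power2_eq_square)
    ultimately show "((\<lambda>x. k x / k' x - (1 - \<alpha>) * x) has_field_derivative 0) (at x within ball 0 r)"
      by (simp add: has_field_derivative_at_within)
  qed simp
  then have const: "k x / k' x - (1 - \<alpha>) * x = k 0 / k' 0" if "x \<in> ball 0 r" for x
    using that r by (metis centre_in_ball diff_zero mult_zero_right)
  have near: "(1 - s * x) * k' x - of_real \<gamma> * k x = 0" if x: "x \<in> ball 0 r" for x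
    using const[OF x] nz[OF x] \<gamma>_pos k_0 deriv_k_0 by (simp add: s_def field_simps)
  have "(1 - s * x) * k' x - of_real \<gamma> * k x = 0" if x: "x \<in> unit_disk" for x
  proof (rule analytic_continuation[where S = unit_disk and f = "\<lambda>x. (1 - s * x) * k' x - of_real \<gamma> * k x"
        and U = "ball 0 r" and \<xi> = 0])
    show "(\<lambda>x. (1 - s * x) * k' x - of_real \<gamma> * k x) holomorphic_on unit_disk"
      by (intro holomorphic_intros k_holomorphic deriv_k_holomorphic)
    show "(0::complex) islimpt ball 0 r" using r by (simp add: interior_limit_point)
  qed (use near sub x in auto)
  then show ?thesis by (intro exI[of _ s]) simp
qed

text \<open>Multiplying \<open>first_order\<close> by \<open>(1 - s * x) * D\<close> replaces both
  occurrences of \<open>k'\<close> by multiples of \<open>k\<close>; the common factor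
  \<open>of_real \<gamma> * A * k x\<close> then cancels.\<close>

lemma Moebius_relation:
  assumes ode: "\<forall>x\<in>unit_disk. (1 - s * x) * k' x = of_real \<gamma> * k x"
    and z: "z \<in> unit_disk"
  shows "E * (\<phi> z - b) = z * (1 - s * (b * cnj b)) * (1 - s * (cnj b * \<phi> z))"
proof -
  define A B D u x where defs: "A = k (b * cnj b)" "B = k' (b * cnj b)" "D = 1 - s * (b * cnj b)"
    "u = \<phi> z" "x = cnj b * \<phi> z"
  have B: "D * B = of_real \<gamma> * A"
    unfolding defs by (intro ode[rule_format] disk_mult_mem b_mem)
  have x: "(1 - s * x) * k' x = of_real \<gamma> * k x"
    unfolding defs by (intro ode[rule_format] disk_mult_mem b_mem \<phi>_mem z)
  have nz: "of_real \<gamma> * A * k x \<noteq> 0"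
    using k_b\<phi>_nonzero[OF z] k_bb_nonzero \<gamma>_pos unfolding defs by simp
  have f: "A * E * u * k' x = k x * (z * of_real \<gamma> * A + b * E * B)"
    using first_order[OF z] unfolding defs .
  have "of_real \<gamma> * A * k x * (E * u * D) = A * E * u * ((1 - s * x) * k' x) * D"
    unfolding x by (simp add: mult_ac)
  also have "\<dots> = (A * E * u * k' x) * (1 - s * x) * D" by (simp add: mult_ac)
  also have "\<dots> = k x * (1 - s * x) * (z * of_real \<gamma> * A * D + b * E * (D * B))"
    unfolding f by (simp add: algebra_simps)
  also have "\<dots> = of_real \<gamma> * A * k x * ((1 - s * x) * (z * D + b * E))"
    unfolding B by (simp add: algebra_simps)
  finally have "E * u * D = (1 - s * x) * (z * D + b * E)"
    using nz by simp
  then show ?thesis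
    unfolding defs by (simp add: algebra_simps)
qed

lemma ode_slope_eq_1:
  assumes ode: "\<forall>x\<in>unit_disk. (1 - s * x) * k' x = of_real \<gamma> * k x"
  shows slope_eq_1: "s = 1" and cmod_E: "cmod E = 1 - (cmod b)\<^sup>2"
proof -
  note bb = real_bb
  have 0: "(0::complex) \<in> unit_disk" by simp
  define D where "D = 1 - s * (b * cnj b)"
  have "D * k' (b * cnj b) = of_real \<gamma> * k (b * cnj b)"
    unfolding D_def by (intro ode[rule_format] disk_mult_mem b_mem)
  then have D_nz: "D \<noteq> 0" using k_bb_nonzero \<gamma>_pos by auto
  note M = Moebius_relation[OF ode, folded D_def]
  \<comment> \<open>The derivative of the Moebius relation at 0, where \<open>\<phi>\<close> has
    derivative \<open>cnj E\<close>. It makes \<open>D\<close> real, and therefore \<open>s\<close>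
    as well.\<close>
  have "E * cnj E = D * D"
  proof (rule DERIV_unique_on_open[OF _ _ open_ball 0 M])
    have \<phi>: "(\<phi> has_field_derivative cnj E) (at 0)"
      using holomorphic_derivI[OF \<phi>_holomorphic open_ball 0] by (simp add: deriv_\<phi>_0)
    show "((\<lambda>z. E * (\<phi> z - b)) has_field_derivative E * cnj E) (at 0)"
      by (rule derivative_eq_intros \<phi> refl)+ simp
    show "((\<lambda>z. z * D * (1 - s * (cnj b * \<phi> z))) has_field_derivative D * D) (at 0)"
      by (rule derivative_eq_intros \<phi> refl)+ (simp add: D_def mult_ac)
  qed
  then have "D\<^sup>2 = (of_real (cmod E))\<^sup>2"
    using complex_norm_square[of E] by (simp add: power2_eq_square)
  then have D_cases: "D = of_real (cmod E) \<or> D = - of_real (cmod E)"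
    by (simp add: power2_eq_iff)
  then have "D = of_real (Re D)" by auto
  moreover have "s = (1 - D) / of_real ((cmod b)\<^sup>2)"
    using moving by (simp add: D_def bb(1))
  ultimately have "s = of_real ((1 - Re D) / (cmod b)\<^sup>2)"
    by (metis of_real_1 of_real_diff of_real_divide)
  then obtain \<sigma> :: real where \<sigma>: "s = of_real \<sigma>" by blast
  \<comment> \<open>Otherwise \<open>1 - s * x\<close> vanishes at \<open>1 / \<sigma>\<close> in
    (0,1), and the equation would force a zero of \<open>k\<close> there.\<close>
  have "\<sigma> \<le> 1"
  proof (rule ccontr)
    assume "\<not> \<sigma> \<le> 1"
    then have "0 \<le> 1 / \<sigma>" "1 / \<sigma> < 1" by auto
    moreover from this have "(1 - s * of_real (1 / \<sigma>)) * k' (of_real (1 / \<sigma>)) = of_real \<gamma> * k (of_real (1 / \<sigma>))"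
      by (intro ode[rule_format]) (simp add: norm_divide)
    ultimately show False using k_of_real(3)[of "1 / \<sigma>"] \<gamma>_pos \<sigma> \<open>\<not> \<sigma> \<le> 1\<close> by auto
  qed
  have D_real: "D = of_real (1 - \<sigma> * (cmod b)\<^sup>2)"
    unfolding D_def bb(1) \<sigma> by simp
  have "\<sigma> * (cmod b)\<^sup>2 \<le> 1 * (cmod b)\<^sup>2"
    using \<open>\<sigma> \<le> 1\<close> by (intro mult_right_mono) auto
  then have D_pos: "1 - \<sigma> * (cmod b)\<^sup>2 > 0" using bb(2) by simp
  then have "Re D > 0" by (simp add: D_real)
  then have D_E: "D = of_real (cmod E)" using D_cases by auto
  have "\<sigma> \<ge> 1"
  proof (rule slope_ge_1)
    show "0 < cmod b" "cmod b < 1" using moving b_mem by auto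
    fix t :: real assume t: "0 \<le> t" "t < 1"
    \<comment> \<open>The unimodular factor \<open>E / D\<close> undoes the rotation in the Moebius
      relation, so \<open>\<phi> z\<close> times \<open>1 + \<sigma> * cmod b * t\<close> lies on
      the ray through \<open>b\<close> and has modulus \<open>t + cmod b\<close>.\<close>
    define z where "z = of_real t * (E / D) * (b / of_real (cmod b))"
    have E_D: "cmod (E / D) = 1" using D_nz D_E E_nonzero by (simp add: norm_divide)
    have z: "z \<in> unit_disk"
      using t moving E_D by (simp add: z_def norm_mult norm_divide)
    have "(E / D) * (\<phi> z - b) = z * (1 - s * (cnj b * \<phi> z))"
      using M[OF z] D_nz by (simp add: field_simps)
    also have "\<dots> = (E / D) * (of_real t * (b / of_real (cmod b)) * (1 - s * (cnj b * \<phi> z)))"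
      by (simp add: z_def)
    finally have "\<phi> z - b = of_real t * (b / of_real (cmod b)) * (1 - s * (cnj b * \<phi> z))"
      using E_D by (metis mult_left_cancel norm_zero zero_neq_one)
    also have "\<dots> = of_real t * (b / of_real (cmod b)) - of_real t * (b * cnj b / of_real (cmod b)) * s * \<phi> z"
      by (simp add: algebra_simps diff_divide_distrib)
    also have "b * cnj b / of_real (cmod b) = of_real (cmod b)"
      unfolding bb(1) using moving by (simp add: power2_eq_square)
    finally have "\<phi> z * (1 + s * of_real (cmod b) * of_real t) = b / of_real (cmod b) * (of_real t + of_real (cmod b))"
      using moving by (simp add: field_simps)
    then have "cmod (\<phi> z * of_real (1 + \<sigma> * cmod b * t)) = cmod (b / of_real (cmod b) * of_real (t + cmod b))"
      by (simp add: \<sigma>)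
    then have eq: "cmod (\<phi> z) * \<bar>1 + \<sigma> * cmod b * t\<bar> = t + cmod b"
      using moving t unfolding norm_mult norm_of_real norm_divide by simp
    have "t + cmod b > 0" using t moving by (simp add: add_nonneg_pos)
    then have "\<bar>1 + \<sigma> * cmod b * t\<bar> > 0" using eq by (cases "1 + \<sigma> * cmod b * t = 0") auto
    then have "cmod (\<phi> z) * \<bar>1 + \<sigma> * cmod b * t\<bar> < 1 * \<bar>1 + \<sigma> * cmod b * t\<bar>"
      using \<phi>_mem[OF z] by (intro mult_strict_right_mono) auto
    then show "t + cmod b < \<bar>1 + \<sigma> * cmod b * t\<bar>" using eq by simp
  qed
  with \<open>\<sigma> \<le> 1\<close> have "\<sigma> = 1" by simp
  then show "s = 1" using \<sigma> by simp
  have "complex_of_real (cmod E) = of_real (1 - (cmod b)\<^sup>2)"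
    using D_E D_real \<open>\<sigma> = 1\<close> by simp
  then show "cmod E = 1 - (cmod b)\<^sup>2"
    by (simp only: of_real_eq_iff)
qed

lemma k_eq_powr_if_moving:
  assumes "x \<in> unit_disk"
  shows "k x = (1 - x) powr (- of_real \<gamma>)"
proof -
  obtain s where ode: "\<forall>x\<in>unit_disk. (1 - s * x) * k' x = of_real \<gamma> * k x"
    using first_order_ode by blast
  show ?thesis
    using ode slope_eq_1[OF ode] assms by (intro k_eq_powr) auto
qed

lemma disk_automorphism_if_moving: "disk_automorphism \<phi>"
proof -
  obtain s where ode: "\<forall>x\<in>unit_disk. (1 - s * x) * k' x = of_real \<gamma> * k x"
    using first_order_ode by blast
  note s = slope_eq_1[OF ode] and E = cmod_E[OF ode]
  define D where "D = 1 - (cmod b)\<^sup>2"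
  have D: "D > 0" using real_bb by (simp add: D_def)
  have M: "E * (\<phi> z - b) = z * of_real D * (1 - cnj b * \<phi> z)" if "z \<in> unit_disk" for z
    using Moebius_relation[OF ode that] by (simp add: s D_def real_bb(1))
  have "u \<in> \<phi> ` unit_disk" if u: "u \<in> unit_disk" for u
  proof -
    define m where "m = Moebius_function 0 b u"
    \<comment> \<open>Chosen so that \<open>\<phi> z\<close> satisfies the same Moebius equation,
      with parameter \<open>m\<close>, as \<open>u\<close>; that equation has only one solution. The
      bound on \<open>z\<close> uses \<open>cmod E = D\<close>.\<close>
    define z where "z = E / of_real D * m"
    have m: "cmod m < 1"
      unfolding m_def using Moebius_function_norm_lt_1[of b u 0] b_mem u by simp
    then have z: "z \<in> unit_disk" using E D by (simp add: z_def norm_mult norm_divide flip: D_def)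
    have "1 - cnj b * u \<noteq> 0" using disk_mult_mem[OF b_mem(2) u] by auto
    then have m_eq: "u - b = m * (1 - cnj b * u)"
      by (simp add: m_def Moebius_function_simple)
    have "\<phi> z - b = m * (1 - cnj b * \<phi> z)"
    proof -
      have "E * (\<phi> z - b) = E * (m * (1 - cnj b * \<phi> z))"
        using M[OF z] D by (simp add: z_def)
      then show ?thesis using E_nonzero by simp
    qed
    with m_eq have "(\<phi> z - u) * (1 + m * cnj b) = 0" by (simp add: algebra_simps)
    moreover have "1 + m * cnj b \<noteq> 0"
      using disk_mult_mem[of m "cnj b"] m b_mem by (metis add_eq_0_iff mem_ball_0 norm_minus_cancel norm_one order_less_irrefl)
    ultimately have "\<phi> z = u" by simp
    with z show ?thesis by blast
  qed
  then show ?thesis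
    using \<phi>_mem \<phi>_inj \<phi>_holomorphic unfolding disk_automorphism_def bij_betw_def by blast
qed

end

subsection \<open>Disk automorphisms\<close>

lemma one_minus_disk:
  assumes "x \<in> unit_disk"
  shows "1 - x \<notin> \<real>\<^sub>\<le>\<^sub>0" "1 - x \<noteq> 0"
proof -
  have "Re (1 - x) > 0" using assms complex_Re_le_cmod[of x] by simp
  then show "1 - x \<notin> \<real>\<^sub>\<le>\<^sub>0" "1 - x \<noteq> 0"
    by (auto simp: complex_nonpos_Reals_iff)
qed

text \<open>From \<open>exp (f x) * deriv f x = 0\<close> such an \<open>f\<close> is constant.
  Applied to a combination of principal logarithms, this excludes a multiple of 2 pi i once it is
  excluded at one point.\<close>

lemma log_one_unique:
  assumes f: "f holomorphic_on unit_disk" and exp: "\<And>z. z \<in> unit_disk \<Longrightarrow> exp (f z) = 1"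
    and a: "a \<in> unit_disk" "f a = 0" and z: "z \<in> unit_disk"
  shows "f z = 0"
proof -
  have "\<exists>c. \<forall>z\<in>unit_disk. f z = c"
  proof (rule has_field_derivative_zero_constant)
    fix x :: complex assume x: "x \<in> unit_disk"
    have f': "(f has_field_derivative deriv f x) (at x)"
      using holomorphic_derivI[OF f open_ball x] .
    have "exp (f x) * deriv f x = 0"
      by (rule DERIV_unique_on_open[OF _ DERIV_const open_ball x exp])
        (rule derivative_eq_intros f' refl)+
    then show "(f has_field_derivative 0) (at x within unit_disk)"
      using f' by (simp add: has_field_derivative_at_within)
  qed simp
  then show ?thesis using a z by metis
qed

lemma rotation_imp_automorphism:
  assumes "rotation \<phi>"
  shows "disk_automorphism \<phi>"
proof -
  obtain c where c: "cmod c = 1" "\<And>z. z \<in> unit_disk \<Longrightarrow> \<phi> z = c * z"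
    using assms unfolding rotation_def by blast
  have "c \<noteq> 0" using c(1) by auto
  have "\<phi> holomorphic_on unit_disk"
    by (rule holomorphic_transform[of "\<lambda>z. c * z"]) (auto intro!: holomorphic_intros simp: c)
  moreover have "inj_on \<phi> unit_disk"
    using \<open>c \<noteq> 0\<close> by (intro inj_onI) (simp add: c)
  moreover have "\<phi> ` unit_disk = unit_disk"
  proof
    show "\<phi> ` unit_disk \<subseteq> unit_disk" using c by (auto simp: norm_mult)
    show "unit_disk \<subseteq> \<phi> ` unit_disk"
    proof
      fix u assume u: "u \<in> unit_disk"
      then have m: "u / c \<in> unit_disk" using c(1) by (simp add: norm_divide)
      then have "\<phi> (u / c) = u" using \<open>c \<noteq> 0\<close> by (simp add: c(2)[OF m])
      then show "u \<in> \<phi> ` unit_disk" using m by (metis imageI)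
    qed
  qed
  ultimately show ?thesis by (simp add: disk_automorphism_def bij_betw_def)
qed

text \<open>Schwarz's lemma for \<open>f\<close> and for its left inverse \<open>g\<close> gives
  inequalities in both directions, hence equality at 1/2 and the rigid case.\<close>

lemma Schwarz_rotation:
  assumes f: "f holomorphic_on unit_disk" "f 0 = 0" and g: "g holomorphic_on unit_disk" "g 0 = 0"
    and maps: "\<And>z. z \<in> unit_disk \<Longrightarrow> f z \<in> unit_disk" "\<And>z. z \<in> unit_disk \<Longrightarrow> g z \<in> unit_disk"
    and inv: "\<And>z. z \<in> unit_disk \<Longrightarrow> g (f z) = z"
  shows "\<exists>l. cmod l = 1 \<and> (\<forall>z\<in>unit_disk. f z = l * z)"
proof -
  have ltf: "norm (f z) < 1" and ltg: "norm (g z) < 1" if "norm z < 1" for z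
    using maps[of z] that by auto
  have half: "norm (1/2 :: complex) < 1" by (simp add: norm_divide)
  have "norm (f (1/2)) \<le> norm (1/2 :: complex)" by (rule Schwarz_Lemma(1)[OF f ltf half])
  moreover have "norm (g (f (1/2))) \<le> norm (f (1/2))" by (rule Schwarz_Lemma(1)[OF g ltg ltf[OF half]])
  ultimately have "norm (f (1/2)) = norm (1/2 :: complex)" using inv[of "1/2"] half by simp
  then have "\<exists>\<alpha>. (\<forall>z. norm z < 1 \<longrightarrow> f z = \<alpha> * z) \<and> norm \<alpha> = 1"
    using Schwarz_Lemma(3)[OF f ltf half] half by (metis divide_eq_0_iff zero_neq_numeral zero_neq_one)
  then show ?thesis by auto
qed

lemma disk_automorphism_Moebius:
  assumes aut: "disk_automorphism \<phi>" and a_def: "a = the_inv_into unit_disk \<phi> 0"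
  shows "a \<in> unit_disk" and "\<phi> a = 0"
    and "\<exists>l. cmod l = 1 \<and> (\<forall>z\<in>unit_disk. \<phi> z = l * (z - a) / (1 - cnj a * z))"
proof -
  have hol: "\<phi> holomorphic_on unit_disk" and inj: "inj_on \<phi> unit_disk" and img: "\<phi> ` unit_disk = unit_disk"
    using aut by (auto simp: disk_automorphism_def bij_betw_def)
  show a: "a \<in> unit_disk" "\<phi> a = 0"
    unfolding a_def using inj img the_inv_into_into[OF inj] f_the_inv_into_f[OF inj]
    by (metis centre_in_ball order_refl zero_less_one)+
  obtain h where h: "h holomorphic_on \<phi> ` unit_disk" "\<And>z. z \<in> unit_disk \<Longrightarrow> h (\<phi> z) = z"
    using holomorphic_has_inverse[OF hol open_ball inj] by metis
  let ?M = "Moebius_function 0"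
  have M: "?M a z \<in> unit_disk" "?M (-a) z \<in> unit_disk" if "z \<in> unit_disk" for z
    using that a Moebius_function_norm_lt_1 by auto
  have MM: "?M (-a) (?M a z) = z" "?M a (?M (-a) z) = z" if "z \<in> unit_disk" for z
    using that a by (auto intro!: Moebius_function_compose)
  have Mhol: "?M a holomorphic_on unit_disk" "?M (-a) holomorphic_on unit_disk"
    using a by (auto intro!: Moebius_function_holomorphic)
  have h_mem: "h z \<in> unit_disk" if "z \<in> unit_disk" for z
    using h(2) that img by (metis imageE)
  have \<phi>_mem: "\<phi> z \<in> unit_disk" if "z \<in> unit_disk" for z using img that by blast
  \<comment> \<open>Precomposition with the Moebius map sending 0 to \<open>a\<close> yields an
    automorphism fixing 0.\<close>
  have "\<exists>l. cmod l = 1 \<and> (\<forall>z\<in>unit_disk. \<phi> (?M (-a) z) = l * z)"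
  proof (rule Schwarz_rotation[of "\<lambda>z. \<phi> (?M (-a) z)" "\<lambda>z. ?M a (h z)"])
    show "(\<lambda>z. \<phi> (?M (-a) z)) holomorphic_on unit_disk"
      using holomorphic_on_compose_gen[OF Mhol(2) hol] M unfolding o_def by blast
    show "(\<lambda>z. ?M a (h z)) holomorphic_on unit_disk"
      using holomorphic_on_compose_gen[OF h(1)[unfolded img] Mhol(1)] h_mem unfolding o_def by blast
    show "\<phi> (?M (-a) 0) = 0" using a by (simp add: Moebius_function_of_zero)
    have "h 0 = a" using h(2)[OF a(1)] a(2) by simp
    then show "?M a (h 0) = 0" by (simp add: Moebius_function_eq_zero)
    show "\<phi> (?M (-a) z) \<in> unit_disk" "?M a (h z) \<in> unit_disk" if "z \<in> unit_disk" for z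
      using \<phi>_mem M h_mem that by blast+
    show "?M a (h (\<phi> (?M (-a) z))) = z" if "z \<in> unit_disk" for z
      using h(2)[OF M(2)[OF that]] MM(2)[OF that] by simp
  qed
  then obtain l where l: "cmod l = 1" "\<And>z. z \<in> unit_disk \<Longrightarrow> \<phi> (?M (-a) z) = l * z" by blast
  have "\<phi> z = l * (z - a) / (1 - cnj a * z)" if "z \<in> unit_disk" for z
    using l(2)[OF M(1)[OF that]] MM(1)[OF that] by (simp add: Moebius_function_simple)
  with l(1) show "\<exists>l. cmod l = 1 \<and> (\<forall>z\<in>unit_disk. \<phi> z = l * (z - a) / (1 - cnj a * z))"
    by blast
qed

text \<open>The polarized form of the classical formula for \<open>1 - |\<phi> z|^2\<close>; the
  rotation constant disappears through \<open>cnj l * l = 1\<close>.\<close>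

lemma one_minus_cnj_Moebius:
  fixes a l w z :: complex
  assumes l: "cmod l = 1" and w: "1 - a * cnj w \<noteq> 0" and z: "1 - cnj a * z \<noteq> 0"
  shows "1 - cnj (l * (w - a) / (1 - cnj a * w)) * (l * (z - a) / (1 - cnj a * z)) =
    (1 - cnj a * a) * (1 - cnj w * z) / ((1 - a * cnj w) * (1 - cnj a * z))"
proof -
  have ll: "cnj l * l = 1" using l by (metis complex_norm_square mult.commute of_real_1 power_one)
  have "cnj (l * (w - a) / (1 - cnj a * w)) * (l * (z - a) / (1 - cnj a * z)) =
    (cnj l * l) * ((cnj w - cnj a) * (z - a)) / ((1 - a * cnj w) * (1 - cnj a * z))"
    by simp
  also have "1 - \<dots> = ((1 - a * cnj w) * (1 - cnj a * z) - (cnj w - cnj a) * (z - a)) / ((1 - a * cnj w) * (1 - cnj a * z))"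
    unfolding ll using w z by (simp add: diff_divide_distrib)
  also have "(1 - a * cnj w) * (1 - cnj a * z) - (cnj w - cnj a) * (z - a) = (1 - cnj a * a) * (1 - cnj w * z)"
    by (simp add: algebra_simps)
  finally show ?thesis .
qed

text \<open>A logarithm of the preceding factorization. At \<open>z = a\<close> the Moebius map
  vanishes and both sides coincide, so no multiple of 2 pi i can occur elsewhere.\<close>

lemma Ln_one_minus_Moebius:
  assumes l: "cmod l = 1" and a: "a \<in> unit_disk"
    and maps: "\<And>z. z \<in> unit_disk \<Longrightarrow> l * (z - a) / (1 - cnj a * z) \<in> unit_disk"
    and w: "w \<in> unit_disk" and z: "z \<in> unit_disk"
  shows "Ln (1 - cnj (l * (w - a) / (1 - cnj a * w)) * (l * (z - a) / (1 - cnj a * z)))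
     + Ln (1 - a * cnj w) + Ln (1 - cnj a * z) = Ln (1 - cnj a * a) + Ln (1 - cnj w * z)"
proof -
  define \<phi> where "\<phi> = (\<lambda>z. l * (z - a) / (1 - cnj a * z))"
  define f where "f = (\<lambda>z. Ln (1 - cnj (\<phi> w) * \<phi> z) + Ln (1 - a * cnj w) + Ln (1 - cnj a * z)
     - Ln (1 - cnj a * a) - Ln (1 - cnj w * z))"
  have cnj: "cnj x \<in> unit_disk" if "x \<in> unit_disk" for x using that by simp
  have \<phi>: "\<phi> z \<in> unit_disk" if "z \<in> unit_disk" for z using maps[OF that] by (simp add: \<phi>_def)
  have dw: "cnj (\<phi> w) * \<phi> z \<in> unit_disk" "cnj a * z \<in> unit_disk" "cnj w * z \<in> unit_disk" if "z \<in> unit_disk" for z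
    using that by (intro disk_mult_mem cnj \<phi> a w; assumption)+
  have aw: "a * cnj w \<in> unit_disk" by (intro disk_mult_mem cnj a w)
  have "f z = 0"
  proof (rule log_one_unique[OF _ _ a _ z])
    show "f holomorphic_on unit_disk"
      unfolding f_def \<phi>_def
      by (intro holomorphic_intros one_minus_disk dw[unfolded \<phi>_def]) auto
    show "exp (f z) = 1" if z: "z \<in> unit_disk" for z
    proof -
      note nz = one_minus_disk(2)[OF aw] one_minus_disk(2)[OF dw(2)[OF z]] one_minus_disk(2)[OF dw(3)[OF z]]
        one_minus_disk(2)[OF dw(2)[OF a]]
      have "exp (f z) = (1 - cnj (\<phi> w) * \<phi> z) * (1 - a * cnj w) * (1 - cnj a * z) / (1 - cnj a * a) / (1 - cnj w * z)"
        unfolding f_def exp_add exp_diff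
        by (simp only: exp_Ln one_minus_disk(2)[OF dw(1)[OF z]] nz not_False_eq_True)
      also have "1 - cnj (\<phi> w) * \<phi> z = (1 - cnj a * a) * (1 - cnj w * z) / ((1 - a * cnj w) * (1 - cnj a * z))"
        unfolding \<phi>_def by (rule one_minus_cnj_Moebius[OF l nz(1,2)])
      finally show ?thesis using nz by simp
    qed
    show "f a = 0" by (simp add: f_def \<phi>_def mult.commute)
  qed
  then show ?thesis by (simp add: f_def \<phi>_def algebra_simps)
qed

subsection \<open>Characterization of unitary weighted composition operators\<close>

context weighted_hardy_space
begin

lemma k_holomorphic: "k holomorphic_on unit_disk"
  using k_sums by (intro power_series_holomorphic[where a = "\<lambda>n. of_real (c n)"]) auto

lemma k_0: "k 0 = 1"
  using k_sums[of 0] c_0 by (simp add: sums_iff)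

lemma deriv_k_0: "deriv k 0 = of_real (c 1)"
proof (rule DERIV_imp_deriv)
  have "(k has_field_derivative (\<Sum>n. diffs (\<lambda>n. of_real (c n)) n * 0 ^ n)) (at 0)"
    unfolding k_def
    using k_sums[of "1/2"] by (intro termdiffs_strong[where K = "1/2"]) (auto simp: sums_iff norm_divide)
  then show "(k has_field_derivative of_real (c 1)) (at 0)" by (simp add: diffs_def)
qed

lemma cnj_k: "x \<in> unit_disk \<Longrightarrow> cnj (k x) = k (cnj x)"
  using k_sums[of x] k_sums[of "cnj x"] sums_cnj[of "\<lambda>n. of_real (c n) * x ^ n" "k x"]
  by (auto dest: sums_unique2)

lemma k_mono: "strict_mono_on {0..<1} (\<lambda>x. Re (k (of_real x)))"
proof (rule strict_mono_onI)
  fix x y :: real assume x: "x \<in> {0..<1}" and y: "y \<in> {0..<1}" and "x < y"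
  have s: "(\<lambda>n. c n * x ^ n) sums Re (k (of_real x))" if "x \<in> {0..<1}" for x
    using sums_Re[OF k_sums[of "of_real x"]] that by simp
  have d: "(\<lambda>n. c n * y ^ n - c n * x ^ n) sums (Re (k (of_real y)) - Re (k (of_real x)))"
    by (intro sums_diff s x y)
  \<comment> \<open>Strictness comes from the linear term; the constant term contributes 0.\<close>
  have "0 < (\<Sum>n. c n * y ^ n - c n * x ^ n)"
  proof (rule suminf_pos2[where i = 1])
    show "summable (\<lambda>n. c n * y ^ n - c n * x ^ n)" using d by (rule sums_summable)
    show "0 \<le> c n * y ^ n - c n * x ^ n" for n
      using c_pos[of n] x \<open>x < y\<close> by (simp add: power_mono)
    show "0 < c 1 * y ^ 1 - c 1 * x ^ 1" using c_pos[of 1] \<open>x < y\<close> by simp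
  qed
  then show "Re (k (of_real x)) < Re (k (of_real y))" using d by (simp add: sums_iff)
qed

text \<open>The only candidate for the exponent is \<open>c 1\<close>, because
  \<open>(1 - x) powr (-\<gamma>)\<close> has linear coefficient \<open>\<gamma>\<close>.\<close>

sublocale positive_kernel k "c 1"
  by unfold_locales (use k_holomorphic k_0 deriv_k_0 cnj_k k_mono c_pos in auto)

lemma is_H_gamma_iff:
  "is_H_gamma g H ip \<longleftrightarrow> (\<forall>x\<in>unit_disk. k x = (1 - x) powr (- complex_of_real g))"
proof
  assume g: "is_H_gamma g H ip"
  show "\<forall>x\<in>unit_disk. k x = (1 - x) powr (- complex_of_real g)"
  proof
    fix x :: complex assume "x \<in> unit_disk"
    then obtain w z where "w \<in> unit_disk" "z \<in> unit_disk" "x = cnj w * z"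
      by (rule disk_factor)
    then show "k x = (1 - x) powr (- complex_of_real g)"
      using g unfolding is_H_gamma_def by (simp flip: rep_kernel_eq)
  qed
next
  assume k: "\<forall>x\<in>unit_disk. k x = (1 - x) powr (- complex_of_real g)"
  have "K w z = (1 - cnj w * z) powr (- complex_of_real g)" if "w \<in> unit_disk" "z \<in> unit_disk" for w z
    unfolding rep_kernel_eq[OF that] using k that by (intro bspec[OF k] disk_mult_mem) auto
  then show "is_H_gamma g H ip"
    unfolding is_H_gamma_def using disk_rkhs_axioms by blast
qed

end

section \<open>From solutions of the kernel identity to the two descriptions of unitary
  operators\<close>

context bounded_weighted_composition
begin

lemma kernel_symbolI: "kernel_identity k F \<phi> \<Longrightarrow> kernel_symbol k (c 1) F \<phi>"
  using \<phi>_holomorphic \<phi>_mem by unfold_locales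

lemma kernel_identity_cases:
  assumes id: "kernel_identity k F \<phi>"
  obtains (rotation) "rotation \<phi>" "\<exists>c. cmod c = 1 \<and> (\<forall>z\<in>unit_disk. F z = c)"
  | (moving) "disk_automorphism \<phi>" "is_H_gamma (c 1) H ip"
proof (cases "\<phi> 0 = 0")
  case True
  then show ?thesis
    using kernel_symbol.rotation_if_fixes_0[OF kernel_symbolI[OF id]] rotation by blast
next
  case False
  then interpret kernel_symbol_moving k "c 1" F \<phi>
    using kernel_symbolI[OF id] by (simp add: kernel_symbol_moving_def kernel_symbol_moving_axioms_def)
  show ?thesis
    by (rule that(2)[OF disk_automorphism_if_moving]) (simp add: is_H_gamma_iff k_eq_powr_if_moving)
qed

lemma kernel_identity_if_rotation:
  assumes "rotation \<phi>" "cmod l = 1" "\<And>z. z \<in> unit_disk \<Longrightarrow> F z = l"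
  shows "kernel_identity k F \<phi>"
proof -
  obtain m where m: "cmod m = 1" "\<And>z. z \<in> unit_disk \<Longrightarrow> \<phi> z = m * z"
    using assms(1) unfolding rotation_def by blast
  have unit: "cnj x * x = 1" if "cmod x = 1" for x
    using that by (metis complex_norm_square mult.commute of_real_1 power_one)
  have "cnj (\<phi> w) * \<phi> z = cnj w * z" if "w \<in> unit_disk" "z \<in> unit_disk" for w z
  proof -
    have "cnj (\<phi> w) * \<phi> z = (cnj m * m) * (cnj w * z)"
      using m(2)[OF that(1)] m(2)[OF that(2)] by (simp add: mult_ac)
    then show ?thesis using unit[OF m(1)] by simp
  qed
  then show ?thesis
    using assms(3) unit[OF assms(2)] unfolding kernel_identity_def by (simp del: mem_ball)
qed

text \<open>At \<open>w = a\<close> the identity reads \<open>cnj (F a) * F z = K a z\<close>, and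
  its value at \<open>z = a\<close> shows that \<open>cmod (F a)\<close> is the norm of
  \<open>K a\<close>.\<close>

lemma F_if_kernel_identity:
  assumes id: "kernel_identity k F \<phi>" and a: "a \<in> unit_disk" "\<phi> a = 0"
  obtains \<nu> where "cmod \<nu> = 1"
    "\<And>z. z \<in> unit_disk \<Longrightarrow> F z = \<nu> * (K a z / complex_of_real (hnorm ip (K a)))"
proof -
  let ?n = "hnorm ip (K a)"
  have F: "cnj (F a) * F z = K a z" if "z \<in> unit_disk" for z
    using id a that k_0 unfolding kernel_identity_def rep_kernel_eq[OF a(1) that]
    by (metis complex_cnj_zero mult_1_right mult_zero_left)
  have "complex_of_real ((cmod (F a))\<^sup>2) = K a a"
    using F[OF a(1)] by (metis complex_norm_square mult.commute)
  then have "(cmod (F a))\<^sup>2 = ?n\<^sup>2"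
    using hnorm_rep_kernel[OF a(1)] by (metis Re_complex_of_real)
  then have n: "cmod (F a) = ?n"
    using hnorm_nonneg[OF rep_kernel_mem[OF a(1)]] by (simp add: power2_eq_iff_nonneg)
  have "K a 0 = 1" by (rule kernel_at_0[OF a(1)])
  then have nz: "F a \<noteq> 0" using F[of 0] by auto
  show ?thesis
  proof (rule that[of "of_real ?n / cnj (F a)"])
    show "cmod (of_real ?n / cnj (F a)) = 1"
      using nz unfolding n[symmetric] by (simp add: norm_divide)
    show "F z = of_real ?n / cnj (F a) * (K a z / of_real ?n)" if "z \<in> unit_disk" for z
      using F[OF that] nz unfolding n[symmetric] by (simp add: field_simps)
  qed
qed

lemma kernel_identity_if_automorphism:
  assumes g: "is_H_gamma g H ip" and aut: "disk_automorphism \<phi>"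
    and a_def: "a = the_inv_into unit_disk \<phi> 0" and \<nu>: "cmod \<nu> = 1"
    and F: "\<And>z. z \<in> unit_disk \<Longrightarrow> F z = \<nu> * (K a z / complex_of_real (hnorm ip (K a)))"
  shows "kernel_identity k F \<phi>"
  unfolding kernel_identity_def
proof (intro ballI)
  fix w z :: complex assume w: "w \<in> unit_disk" and z: "z \<in> unit_disk"
  note a = disk_automorphism_Moebius(1,2)[OF aut a_def]
  obtain l where l: "cmod l = 1"
    and \<phi>: "\<And>z. z \<in> unit_disk \<Longrightarrow> \<phi> z = l * (z - a) / (1 - cnj a * z)"
    using disk_automorphism_Moebius(3)[OF aut a_def] by blast
  have kx: "k x = exp (- (of_real g * Ln (1 - x)))" if "x \<in> unit_disk" for x
    using g that one_minus_disk[OF that] by (simp add: is_H_gamma_iff powr_def)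
  have cnj_mem: "cnj x \<in> unit_disk" if "x \<in> unit_disk" for x using that by simp
  have mems: "cnj (\<phi> w) * \<phi> z \<in> unit_disk" "a * cnj w \<in> unit_disk" "cnj a * z \<in> unit_disk"
    "cnj a * a \<in> unit_disk" "cnj w * z \<in> unit_disk"
    by (intro disk_mult_mem cnj_mem \<phi>_mem w z a)+
  let ?n = "complex_of_real (hnorm ip (K a))"
  have "cnj \<nu> * \<nu> = 1" using \<nu> by (metis complex_norm_square mult.commute of_real_1 power_one)
  have nn: "?n * ?n = k (cnj a * a)"
    using ip_self[OF rep_kernel_mem[OF a(1)]] reproducing[OF a(1) rep_kernel_mem[OF a(1)]] rep_kernel_eq[OF a(1) a(1)]
    by (simp add: power2_eq_square)
  have nz: "k (cnj a * a) \<noteq> 0" by (simp add: kx[OF mems(4)])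
  have "cnj (K a w) = k (a * cnj w)"
    using cnj_k[OF disk_mult_mem[OF cnj_mem[OF a(1)] w]] by (simp add: rep_kernel_eq[OF a(1) w])
  then have "cnj (F w) * F z = (cnj \<nu> * \<nu>) * (k (a * cnj w) * k (cnj a * z)) / (?n * ?n)"
    unfolding F[OF w] F[OF z] rep_kernel_eq[OF a(1) z] by simp
  then have FF: "cnj (F w) * F z = k (a * cnj w) * k (cnj a * z) / k (cnj a * a)"
    unfolding \<open>cnj \<nu> * \<nu> = 1\<close> nn by simp
  have "k (a * cnj w) * k (cnj a * z) * k (cnj (\<phi> w) * \<phi> z) =
    exp (- (of_real g * (Ln (1 - cnj (\<phi> w) * \<phi> z) + Ln (1 - a * cnj w) + Ln (1 - cnj a * z))))"
    unfolding kx[OF mems(1)] kx[OF mems(2)] kx[OF mems(3)] exp_add[symmetric]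
    by (simp add: algebra_simps)
  also have "Ln (1 - cnj (\<phi> w) * \<phi> z) + Ln (1 - a * cnj w) + Ln (1 - cnj a * z) =
    Ln (1 - cnj a * a) + Ln (1 - cnj w * z)"
    unfolding \<phi>[OF w] \<phi>[OF z]
    by (rule Ln_one_minus_Moebius[OF l a(1) _ w z]) (use \<phi> \<phi>_mem in metis)
  also have "exp (- (of_real g * (Ln (1 - cnj a * a) + Ln (1 - cnj w * z)))) = k (cnj a * a) * k (cnj w * z)"
    unfolding kx[OF mems(4)] kx[OF mems(5)] exp_add[symmetric] by (simp add: algebra_simps)
  finally show "cnj (F w) * F z * k (cnj (\<phi> w) * \<phi> z) = k (cnj w * z)"
    unfolding FF using nz by (simp add: field_simps)
qed

text \<open>Up to constants \<open>deriv \<phi>\<close> is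
  \<open>1 / (1 - cnj a * z)\<^sup>2\<close>, so its power \<open>g / 2\<close> is proportional to
  \<open>K a\<close>. The constant is unimodular because \<open>cmod q\<close> is \<open>d\<close>
  to the power \<open>g / 2\<close>, the reciprocal of the norm of \<open>K a\<close>.\<close>

lemma power_branch_deriv_automorphism:
  assumes g: "is_H_gamma g H ip" and aut: "disk_automorphism \<phi>"
    and a_def: "a = the_inv_into unit_disk \<phi> 0"
  obtains p \<rho> where "power_branch (deriv \<phi>) (g / 2) p" "cmod \<rho> = 1"
    "\<And>z. z \<in> unit_disk \<Longrightarrow> K a z / complex_of_real (hnorm ip (K a)) = \<rho> * p z"
proof -
  note a = disk_automorphism_Moebius(1,2)[OF aut a_def]
  obtain l where l: "cmod l = 1"
    and \<phi>: "\<And>z. z \<in> unit_disk \<Longrightarrow> \<phi> z = l * (z - a) / (1 - cnj a * z)"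
    using disk_automorphism_Moebius(3)[OF aut a_def] by blast
  have kx: "k x = exp (- (of_real g * Ln (1 - x)))" if "x \<in> unit_disk" for x
    using g that one_minus_disk[OF that] by (simp add: is_H_gamma_iff powr_def)
  have az: "cnj a * z \<in> unit_disk" if "z \<in> unit_disk" for z
    using a that by (intro disk_mult_mem) auto
  have aa: "cnj a * a = of_real ((cmod a)\<^sup>2)" by (metis complex_norm_square mult.commute)
  define d where "d = 1 - (cmod a)\<^sup>2"
  have d: "d > 0" "1 - cnj a * a = of_real d" using a by (simp_all add: d_def aa power_less_one_iff)
  have ld: "l * of_real d \<noteq> 0" using l d by auto
  define L where "L z = Ln (l * of_real d) - 2 * Ln (1 - cnj a * z)" for z
  define p where "p z = exp (of_real (g / 2) * L z)" for z
  define q where "q = exp (of_real (g / 2) * Ln (l * of_real d))"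
  define n where "n = hnorm ip (K a)"
  have n2: "n\<^sup>2 = Re (k (cnj a * a))"
    using hnorm_rep_kernel[OF a(1)] by (simp add: n_def rep_kernel_eq[OF a(1) a(1)])
  have "k (cnj a * a) = of_real (exp (- (g * ln d)))"
    unfolding kx[OF az[OF a(1)]] d(2) using d(1) by (simp add: Ln_of_real exp_of_real[symmetric])
  then have "n\<^sup>2 = (exp (- (g * ln d) / 2))\<^sup>2"
    unfolding n2 by (simp flip: exp_double)
  moreover have "n \<ge> 0" unfolding n_def by (rule hnorm_nonneg[OF rep_kernel_mem[OF a(1)]])
  ultimately have n: "n = exp (- (g * ln d) / 2)" by (simp add: power2_eq_iff_nonneg)
  have q: "cmod q = exp (g * ln d / 2)"
    using ld l d(1) by (simp add: q_def Re_Ln norm_mult)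
  have "power_branch (deriv \<phi>) (g / 2) p"
    unfolding power_branch_def
  proof (intro exI[of _ L] conjI ballI)
    show "L holomorphic_on unit_disk"
      unfolding L_def by (intro holomorphic_intros one_minus_disk az)
    fix z :: complex assume z: "z \<in> unit_disk"
    note nz = one_minus_disk(2)[OF az[OF z]]
    have "(\<phi> has_field_derivative l * of_real d / (1 - cnj a * z)\<^sup>2) (at z)"
    proof (rule has_field_derivative_transform_within_open[OF _ open_ball z \<phi>[symmetric]])
      have "l * (1 - cnj a * z) - l * (z - a) * (- cnj a) = l * of_real d"
        unfolding d(2)[symmetric] by (simp add: algebra_simps)
      then show "((\<lambda>z. l * (z - a) / (1 - cnj a * z)) has_field_derivative
          l * of_real d / (1 - cnj a * z)\<^sup>2) (at z)"
        using nz by (auto intro!: derivative_eq_intros simp: power2_eq_square)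
    qed
    then have "deriv \<phi> z = l * of_real d / (1 - cnj a * z)\<^sup>2" by (rule DERIV_imp_deriv)
    then show "exp (L z) = deriv \<phi> z"
      unfolding L_def exp_diff exp_double using nz ld by (simp add: exp_Ln)
  qed (simp add: p_def)
  moreover have "cmod (1 / (of_real n * q)) = 1"
    by (simp add: norm_divide norm_mult q) (simp add: n flip: exp_add)
  moreover have "K a z / of_real (hnorm ip (K a)) = 1 / (of_real n * q) * p z" if z: "z \<in> unit_disk" for z
  proof -
    have "p z = q * exp (- (of_real g * Ln (1 - cnj a * z)))"
      unfolding p_def q_def L_def exp_add[symmetric] by (simp add: algebra_simps)
    then have "p z = q * K a z"
      by (simp add: rep_kernel_eq[OF a(1) z] kx[OF az[OF z]])
    moreover have "q \<noteq> 0" by (simp add: q_def)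
    ultimately show ?thesis by (simp add: n_def)
  qed
  ultimately show ?thesis by (rule that)
qed

lemma unitary_iff_H_gamma:
  assumes g: "is_H_gamma g H ip"
  shows "unitary_operator H ip W \<longleftrightarrow> disk_automorphism \<phi> \<and>
    (\<exists>p \<mu> \<nu>. power_branch (deriv \<phi>) (g / 2) p \<and> cmod \<mu> = 1 \<and> cmod \<nu> = 1 \<and>
      (let a = the_inv_into unit_disk \<phi> 0; K = rep_kernel H ip a
       in \<forall>z\<in>unit_disk. F z = \<mu> * p z \<and> F z = \<nu> * (K z / complex_of_real (hnorm ip K))))"
proof
  assume "unitary_operator H ip W"
  then have id: "kernel_identity k F \<phi>"
    by (simp add: unitary_iff_co_isometric co_isometric_iff)
  then have aut: "disk_automorphism \<phi>"
    by (cases rule: kernel_identity_cases) (auto intro: rotation_imp_automorphism)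
  define a where "a = the_inv_into unit_disk \<phi> 0"
  note a = disk_automorphism_Moebius(1,2)[OF aut a_def]
  obtain \<nu> where \<nu>: "cmod \<nu> = 1"
    "\<And>z. z \<in> unit_disk \<Longrightarrow> F z = \<nu> * (K a z / complex_of_real (hnorm ip (K a)))"
    using F_if_kernel_identity[OF id a] by blast
  obtain p \<rho> where p: "power_branch (deriv \<phi>) (g / 2) p" "cmod \<rho> = 1"
    "\<And>z. z \<in> unit_disk \<Longrightarrow> K a z / complex_of_real (hnorm ip (K a)) = \<rho> * p z"
    using power_branch_deriv_automorphism[OF g aut a_def] by blast
  have "\<forall>z\<in>unit_disk. F z = (\<nu> * \<rho>) * p z \<and> F z = \<nu> * (K a z / complex_of_real (hnorm ip (K a)))"
    using \<nu>(2) p(3) by (simp add: mult.assoc del: mem_ball)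
  moreover have "cmod (\<nu> * \<rho>) = 1" using \<nu>(1) p(2) by (simp add: norm_mult)
  ultimately show "disk_automorphism \<phi> \<and>
    (\<exists>p \<mu> \<nu>. power_branch (deriv \<phi>) (g / 2) p \<and> cmod \<mu> = 1 \<and> cmod \<nu> = 1 \<and>
      (let a = the_inv_into unit_disk \<phi> 0; K = rep_kernel H ip a
       in \<forall>z\<in>unit_disk. F z = \<mu> * p z \<and> F z = \<nu> * (K z / complex_of_real (hnorm ip K))))"
    using aut p(1) \<nu>(1) unfolding Let_def a_def[symmetric] by blast
next
  assume "disk_automorphism \<phi> \<and>
    (\<exists>p \<mu> \<nu>. power_branch (deriv \<phi>) (g / 2) p \<and> cmod \<mu> = 1 \<and> cmod \<nu> = 1 \<and>
      (let a = the_inv_into unit_disk \<phi> 0; K = rep_kernel H ip a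
       in \<forall>z\<in>unit_disk. F z = \<mu> * p z \<and> F z = \<nu> * (K z / complex_of_real (hnorm ip K))))"
  then obtain \<nu> where "disk_automorphism \<phi>" "cmod \<nu> = 1" "\<And>z. z \<in> unit_disk \<Longrightarrow>
      F z = \<nu> * (K (the_inv_into unit_disk \<phi> 0) z / complex_of_real (hnorm ip (K (the_inv_into unit_disk \<phi> 0))))"
    unfolding Let_def by blast
  then show "unitary_operator H ip W"
    unfolding unitary_iff_co_isometric co_isometric_iff
    using kernel_identity_if_automorphism[OF g _ refl] by blast
qed

text \<open>A symbol moving the origin would place \<open>H\<close> in the scale with the positive
  exponent \<open>c 1\<close>.\<close>

lemma unitary_iff_not_H_gamma:
  assumes "\<nexists>g. g > 0 \<and> is_H_gamma g H ip"
  shows "unitary_operator H ip W \<longleftrightarrow> rotation \<phi> \<and> (\<exists>c. cmod c = 1 \<and> (\<forall>z\<in>unit_disk. F z = c))"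
  unfolding unitary_iff_co_isometric co_isometric_iff
proof
  assume "kernel_identity k F \<phi>"
  then show "rotation \<phi> \<and> (\<exists>c. cmod c = 1 \<and> (\<forall>z\<in>unit_disk. F z = c))"
    by (cases rule: kernel_identity_cases) (use assms c_pos in blast)+
qed (use kernel_identity_if_rotation in blast)

end

theorem theorem2:
  fixes H :: "(complex \<Rightarrow> complex) set"
    and ip :: "(complex \<Rightarrow> complex) \<Rightarrow> (complex \<Rightarrow> complex) \<Rightarrow> complex"
    and F \<phi> :: "complex \<Rightarrow> complex"
  assumes "weighted_hardy_space H ip"
    and "F holomorphic_on unit_disk"
    and "\<phi> holomorphic_on unit_disk"
    and "\<phi> ` unit_disk \<subseteq> unit_disk"
    and "bounded_operator H ip (weighted_comp F \<phi>)"
  shows "(unitary_operator H ip (weighted_comp F \<phi>) \<longleftrightarrow> co_isometric H ip (weighted_comp F \<phi>)) \<and>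
     (\<forall>\<gamma>>0. is_H_gamma \<gamma> H ip \<longrightarrow>
        (unitary_operator H ip (weighted_comp F \<phi>) \<longleftrightarrow>
           disk_automorphism \<phi> \<and>
           (\<exists>p \<mu> \<nu>. power_branch (deriv \<phi>) (\<gamma> / 2) p \<and> cmod \<mu> = 1 \<and> cmod \<nu> = 1 \<and>
              (let a = the_inv_into unit_disk \<phi> 0;
                   K = rep_kernel H ip a
               in \<forall>z\<in>unit_disk. F z = \<mu> * p z \<and>
                    F z = \<nu> * (K z / complex_of_real (hnorm ip K)))))) \<and>
     ((\<nexists>\<gamma>. \<gamma> > 0 \<and> is_H_gamma \<gamma> H ip) \<longrightarrow>
        (unitary_operator H ip (weighted_comp F \<phi>) \<longleftrightarrow>
           rotation \<phi> \<and> (\<exists>c. cmod c = 1 \<and> (\<forall>z\<in>unit_disk. F z = c))))"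
proof -
  interpret bounded_weighted_composition H ip F \<phi>
    using assms by (simp add: bounded_weighted_composition_def bounded_weighted_composition_axioms_def)
  show ?thesis
    by (intro conjI allI impI unitary_iff_co_isometric unitary_iff_H_gamma unitary_iff_not_H_gamma)
qed

end
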